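(* Let $k$ be a field and let $(R,<)$ be a totally ordered set which has a countable subset that is dense in the order topology on $R$. Let $V$ be a persistence module over $k$ indexed by $R$ which has the descending chain condition on images and kernels. Then $V$ is (isomorphic to) a direct sum of interval modules.
   Context: A persistence module $V$ (over $k$, indexed by $R$) is a functor from $R$, viewed as a category via its order, to $k$-vector spaces: it consists of $k$-vector spaces $V_t$ for $t\in R$ and linear maps $\rho_{ts}:V_s\to V_t$ for $s\le t$, with $\rho_{ts}\rho_{sr}=\rho_{tr}$ for all $r\le s\le t$ and $\rho_{tt}=1_{V_t}$ for all $t$. Morphisms are natural transformations; direct sums are pointwise. $V$ has the descending chain condition on images and kernels if for all $t,s_1,s_2,\ldots\in R$ with $t\ge s_1>s_2>\cdots$ the chain $V_t\supseteq \operatorname{Im}\rho_{ts_1}\supseteq \operatorname{Im}\rho_{ts_2}\supseteq\cdots$ stabilizes, and for all $t,r_1,r_2,\ldots\in R$ with $t\le\cdots<r_2<r_1$ the chain $V_t\supseteq \operatorname{Ker}\rho_{r_1t}\supseteq \operatorname{Ker}\rho_{r_2t}\supseteq\cdots$ stabilizes. A subset $I\subseteq R$ is an interval if it is non-empty and $r\le s\le t$ with $r,t\in I$ implies $s\in I$. The interval module $k_I$ is the persistence module with $V_t=k$ for $t\in I$, $V_t=0$ for $t\notin I$, and $\rho_{ts}=1$ for $s,t\in I$ with $s\le t$ (all other $\rho_{ts}$ being zero). *)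

theory Defs
  imports
    "HOL-Analysis.Elementary_Topology"
    "HOL-Algebra.AbelCoset"
    "Jordan_Normal_Form.VS_Connect"
begin

text \<open>
  The spaces of a persistence module are modules in the sense of HOL-Algebra, each with its own
  carrier and operations. \<open>pmap V t s\<close> is the structure map from \<open>pspace V s\<close> to \<open>pspace V t\<close>;
  it is relevant only for \<open>s \<le> t\<close> and on the carrier of \<open>pspace V s\<close>.
\<close>

record ('r, 'k, 'v) persistence =
  pspace :: "'r \<Rightarrow> ('k, 'v) module"
  pmap :: "'r \<Rightarrow> 'r \<Rightarrow> 'v \<Rightarrow> 'v"

locale persistence_module =
  fixes K :: "('k, 'c) ring_scheme"
    and V :: "('r::linorder, 'k, 'v) persistence"
  assumes vectorspace_pspace: "vectorspace K (pspace V t)"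
    and linear_map_pmap: "s \<le> t \<Longrightarrow> linear_map K (pspace V s) (pspace V t) (pmap V t s)"
    and pmap_comp:
      "\<lbrakk>r \<le> s; s \<le> t; x \<in> carrier (pspace V r)\<rbrakk> \<Longrightarrow> pmap V t s (pmap V s r x) = pmap V t r x"
    and pmap_refl: "x \<in> carrier (pspace V t) \<Longrightarrow> pmap V t t x = x"

definition persistence_hom ::
    "('k, 'c) ring_scheme \<Rightarrow> ('r::linorder, 'k, 'v) persistence \<Rightarrow> ('r, 'k, 'w) persistence
      \<Rightarrow> ('r \<Rightarrow> 'v \<Rightarrow> 'w) \<Rightarrow> bool" where
  "persistence_hom K V W \<phi> \<longleftrightarrow>
     (\<forall>t. linear_map K (pspace V t) (pspace W t) (\<phi> t)) \<and>
     (\<forall>s t. s \<le> t \<longrightarrow> (\<forall>x\<in>carrier (pspace V s). \<phi> t (pmap V t s x) = pmap W t s (\<phi> s x)))"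

definition persistence_isomorphic ::
    "('k, 'c) ring_scheme \<Rightarrow> ('r::linorder, 'k, 'v) persistence \<Rightarrow> ('r, 'k, 'w) persistence
      \<Rightarrow> bool" where
  "persistence_isomorphic K V W \<longleftrightarrow>
     (\<exists>\<phi> \<psi>. persistence_hom K V W \<phi> \<and> persistence_hom K W V \<psi> \<and>
       (\<forall>t. \<forall>x\<in>carrier (pspace V t). \<psi> t (\<phi> t x) = x) \<and>
       (\<forall>t. \<forall>y\<in>carrier (pspace W t). \<phi> t (\<psi> t y) = y))"

definition dcc_images :: "('r::linorder, 'k, 'v) persistence \<Rightarrow> bool" where
  "dcc_images V \<longleftrightarrow>
     (\<forall>t (s :: nat \<Rightarrow> 'r). s 0 \<le> t \<and> (\<forall>n. s (Suc n) < s n) \<longrightarrow>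
       (\<exists>N. \<forall>n\<ge>N. pmap V t (s n) ` carrier (pspace V (s n)) =
                    pmap V t (s N) ` carrier (pspace V (s N))))"

definition dcc_kernels :: "('r::linorder, 'k, 'v) persistence \<Rightarrow> bool" where
  "dcc_kernels V \<longleftrightarrow>
     (\<forall>t (r :: nat \<Rightarrow> 'r). (\<forall>n. t \<le> r n) \<and> (\<forall>n. r (Suc n) < r n) \<longrightarrow>
       (\<exists>N. \<forall>n\<ge>N. a_kernel (pspace V t) (pspace V (r n)) (pmap V (r n) t) =
                    a_kernel (pspace V t) (pspace V (r N)) (pmap V (r N) t)))"

definition interval :: "'r::linorder set \<Rightarrow> bool" where
  "interval I \<longleftrightarrow> I \<noteq> {} \<and> (\<forall>r\<in>I. \<forall>t\<in>I. \<forall>s. r \<le> s \<and> s \<le> t \<longrightarrow> s \<in> I)"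

text \<open>
  The fields \<open>mult\<close> and \<open>one\<close>, which HOL-Algebra's modules inherit from the record type of rings,
  play no role in a module and are left undefined below.
\<close>

definition interval_module ::
    "('k, 'c) ring_scheme \<Rightarrow> 'r set \<Rightarrow> ('r::linorder, 'k, 'k) persistence" where
  "interval_module K I =
     \<lparr>pspace = (\<lambda>t. \<lparr>carrier = (if t \<in> I then carrier K else {\<zero>\<^bsub>K\<^esub>}),
                    mult = undefined, one = undefined,
                    zero = \<zero>\<^bsub>K\<^esub>, add = add K, smult = mult K\<rparr>),
      pmap = (\<lambda>t s x. if s \<in> I \<and> t \<in> I then x else \<zero>\<^bsub>K\<^esub>)\<rparr>"

definition module_direct_sum ::
    "'j set \<Rightarrow> ('j \<Rightarrow> ('k, 'v) module) \<Rightarrow> ('k, 'j \<Rightarrow> 'v) module" where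
  "module_direct_sum J M =
     \<lparr>carrier = {f \<in> \<Pi>\<^sub>E j\<in>J. carrier (M j). finite {j\<in>J. f j \<noteq> \<zero>\<^bsub>M j\<^esub>}},
      mult = undefined, one = undefined,
      zero = (\<lambda>j\<in>J. \<zero>\<^bsub>M j\<^esub>),
      add = (\<lambda>f g. \<lambda>j\<in>J. f j \<oplus>\<^bsub>M j\<^esub> g j),
      smult = (\<lambda>a f. \<lambda>j\<in>J. a \<odot>\<^bsub>M j\<^esub> f j)\<rparr>"

definition persistence_direct_sum ::
    "'j set \<Rightarrow> ('j \<Rightarrow> ('r::linorder, 'k, 'v) persistence) \<Rightarrow> ('r, 'k, 'j \<Rightarrow> 'v) persistence" where
  "persistence_direct_sum J U =
     \<lparr>pspace = (\<lambda>t. module_direct_sum J (\<lambda>j. pspace (U j) t)),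
      pmap = (\<lambda>t s f. \<lambda>j\<in>J. pmap (U j) t s (f j))\<rparr>"

lemma interval_module_is_persistence_module:
  assumes "field K" and "interval I"
  shows "persistence_module K (interval_module K I)"
proof -
  interpret K: field K by fact
  let ?C = "\<lambda>t. if t \<in> I then carrier K else {\<zero>\<^bsub>K\<^esub>}"
  have sub: "x \<in> ?C t \<Longrightarrow> x \<in> carrier K" for x t
    by (simp split: if_splits)
  have ab: "abelian_group (pspace (interval_module K I) t)" for t
  proof (rule abelian_groupI, simp_all only: interval_module_def persistence.simps
      partial_object.simps monoid.simps ring.simps module.simps)
    fix x assume x: "x \<in> ?C t"
    show "\<zero>\<^bsub>K\<^esub> \<oplus>\<^bsub>K\<^esub> x = x" using sub[OF x] by simp
    show "\<exists>y\<in>?C t. y \<oplus>\<^bsub>K\<^esub> x = \<zero>\<^bsub>K\<^esub>"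
      using x by (intro bexI[of _ "\<ominus>\<^bsub>K\<^esub> x"]) (auto simp: K.l_neg split: if_splits)
    fix y assume y: "y \<in> ?C t"
    show "x \<oplus>\<^bsub>K\<^esub> y \<in> ?C t" using x y by (auto split: if_splits)
    show "x \<oplus>\<^bsub>K\<^esub> y = y \<oplus>\<^bsub>K\<^esub> x" using sub[OF x] sub[OF y] by (rule K.a_comm)
    fix z assume z: "z \<in> ?C t"
    show "x \<oplus>\<^bsub>K\<^esub> y \<oplus>\<^bsub>K\<^esub> z = x \<oplus>\<^bsub>K\<^esub> (y \<oplus>\<^bsub>K\<^esub> z)"
      using sub[OF x] sub[OF y] sub[OF z] by (rule K.a_assoc)
  next
    show "\<zero>\<^bsub>K\<^esub> \<in> ?C t" by simp
  qed
  have mod: "module K (pspace (interval_module K I) t)" for t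
  proof (rule moduleI[OF K.is_cring ab], simp_all only: interval_module_def persistence.simps
      partial_object.simps monoid.simps ring.simps module.simps)
    fix a x assume a: "a \<in> carrier K" and x: "x \<in> ?C t"
    show "a \<otimes>\<^bsub>K\<^esub> x \<in> ?C t" using a x by (simp split: if_splits)
    fix b assume b: "b \<in> carrier K"
    show "(a \<oplus>\<^bsub>K\<^esub> b) \<otimes>\<^bsub>K\<^esub> x = a \<otimes>\<^bsub>K\<^esub> x \<oplus>\<^bsub>K\<^esub> b \<otimes>\<^bsub>K\<^esub> x"
      using a b sub[OF x] by (rule K.l_distr)
    show "(a \<otimes>\<^bsub>K\<^esub> b) \<otimes>\<^bsub>K\<^esub> x = a \<otimes>\<^bsub>K\<^esub> (b \<otimes>\<^bsub>K\<^esub> x)"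
      using a b sub[OF x] by (rule K.m_assoc)
  next
    fix a x y assume a: "a \<in> carrier K" and x: "x \<in> ?C t" and y: "y \<in> ?C t"
    show "a \<otimes>\<^bsub>K\<^esub> (x \<oplus>\<^bsub>K\<^esub> y) = a \<otimes>\<^bsub>K\<^esub> x \<oplus>\<^bsub>K\<^esub> a \<otimes>\<^bsub>K\<^esub> y"
      using sub[OF x] sub[OF y] a by (rule K.r_distr)
  next
    fix x assume x: "x \<in> ?C t"
    show "\<one>\<^bsub>K\<^esub> \<otimes>\<^bsub>K\<^esub> x = x" using sub[OF x] by simp
  qed
  then have vs: "vectorspace K (pspace (interval_module K I) t)" for t
    using assms(1) by (simp add: vectorspace_def)
  show ?thesis
  proof (rule persistence_module.intro)
    show "vectorspace K (pspace (interval_module K I) t)" for t by (rule vs)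
    show "linear_map K (pspace (interval_module K I) s) (pspace (interval_module K I) t)
            (pmap (interval_module K I) t s)" for s t
    proof -
      have "pmap (interval_module K I) t s
          \<in> module_hom K (pspace (interval_module K I) s) (pspace (interval_module K I) t)"
        by (simp add: module_hom_def interval_module_def)
      then show ?thesis
        by (intro linear_map.intro mod_hom.intro mod_hom_axioms.intro vs mod)
    qed
    show "pmap (interval_module K I) t s (pmap (interval_module K I) s r x)
        = pmap (interval_module K I) t r x" if "r \<le> s" "s \<le> t" for r s t x
    proof -
      have "s \<in> I" if "r \<in> I" "t \<in> I"
        using assms(2) that \<open>r \<le> s\<close> \<open>s \<le> t\<close> unfolding interval_def by blast
      then show ?thesis by (auto simp: interval_module_def)
    qed
    show "pmap (interval_module K I) t t x = x"
      if "x \<in> carrier (pspace (interval_module K I) t)" for t x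
      using that by (auto simp: interval_module_def split: if_splits)
  qed
qed

lemma module_direct_sum_mem:
  "f \<in> carrier (module_direct_sum J M) \<longleftrightarrow>
     f \<in> extensional J \<and> (\<forall>j\<in>J. f j \<in> carrier (M j)) \<and> finite {j\<in>J. f j \<noteq> \<zero>\<^bsub>M j\<^esub>}"
  by (auto simp: module_direct_sum_def PiE_iff)

lemma module_direct_sum_simps:
  "\<zero>\<^bsub>module_direct_sum J M\<^esub> = (\<lambda>j\<in>J. \<zero>\<^bsub>M j\<^esub>)"
  "f \<oplus>\<^bsub>module_direct_sum J M\<^esub> g = (\<lambda>j\<in>J. f j \<oplus>\<^bsub>M j\<^esub> g j)"
  "a \<odot>\<^bsub>module_direct_sum J M\<^esub> f = (\<lambda>j\<in>J. a \<odot>\<^bsub>M j\<^esub> f j)"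
  by (simp_all add: module_direct_sum_def)

lemma vectorspace_module_direct_sum:
  assumes K: "field K" and M: "\<And>j. j \<in> J \<Longrightarrow> vectorspace K (M j)"
  shows "vectorspace K (module_direct_sum J M)"
proof -
  interpret K: field K by fact
  have mod: "module K (M j)" if "j \<in> J" for j using M[OF that] by (simp add: vectorspace_def)
  have ab: "abelian_group (M j)" if "j \<in> J" for j using mod[OF that] by (simp add: module_def)
  note [simp] = abelian_groupE(1)[OF ab] abelian_groupE(2)[OF ab] abelian_monoid.l_zero[OF abelian_group.axioms(1)[OF ab]]
    abelian_monoid.r_zero[OF abelian_group.axioms(1)[OF ab]]
    module.smult_closed[OF mod]
  have inv0: "\<ominus>\<^bsub>M j\<^esub> \<zero>\<^bsub>M j\<^esub> = \<zero>\<^bsub>M j\<^esub>" if "j \<in> J" for j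
  proof -
    interpret abelian_group "M j" using that by (rule ab)
    show ?thesis using r_neg[OF zero_closed] by simp
  qed
  have fin_add: "finite {j \<in> J. f j \<oplus>\<^bsub>M j\<^esub> g j \<noteq> \<zero>\<^bsub>M j\<^esub>}"
    if "finite {j \<in> J. f j \<noteq> \<zero>\<^bsub>M j\<^esub>}" "finite {j \<in> J. g j \<noteq> \<zero>\<^bsub>M j\<^esub>}" for f g
    by (rule finite_subset[OF _ finite_UnI[OF that]]) auto
  have fin_smult: "finite {j \<in> J. a \<odot>\<^bsub>M j\<^esub> f j \<noteq> \<zero>\<^bsub>M j\<^esub>}"
    if "finite {j \<in> J. f j \<noteq> \<zero>\<^bsub>M j\<^esub>}" "a \<in> carrier K" for a f
    by (rule finite_subset[OF _ that(1)]) (use that(2) module.smult_r_null[OF mod] in auto)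
  have fin_inv: "finite {j \<in> J. \<ominus>\<^bsub>M j\<^esub> f j \<noteq> \<zero>\<^bsub>M j\<^esub>}"
    if "finite {j \<in> J. f j \<noteq> \<zero>\<^bsub>M j\<^esub>}" for f
    by (rule finite_subset[OF _ that]) (use inv0 in auto)
  have restrict_fin: "{j \<in> J. restrict h J j \<noteq> \<zero>\<^bsub>M j\<^esub>} = {j \<in> J. h j \<noteq> \<zero>\<^bsub>M j\<^esub>}" for h
    by auto
  note mem = module_direct_sum_mem restrict_fin
  note ops = module_direct_sum_simps
  have "abelian_group (module_direct_sum J M)"
  proof (rule abelian_groupI)
    fix f assume f: "f \<in> carrier (module_direct_sum J M)"
    let ?g = "\<lambda>j\<in>J. \<ominus>\<^bsub>M j\<^esub> f j"
    have "?g \<in> carrier (module_direct_sum J M)"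
      using f fin_inv abelian_group.a_inv_closed[OF ab] unfolding mem by simp
    moreover have "?g \<oplus>\<^bsub>module_direct_sum J M\<^esub> f = \<zero>\<^bsub>module_direct_sum J M\<^esub>"
      using f abelian_group.l_neg[OF ab] unfolding mem ops by (auto simp: fun_eq_iff)
    ultimately show "\<exists>g\<in>carrier (module_direct_sum J M).
        g \<oplus>\<^bsub>module_direct_sum J M\<^esub> f = \<zero>\<^bsub>module_direct_sum J M\<^esub>" by blast
    show "\<zero>\<^bsub>module_direct_sum J M\<^esub> \<oplus>\<^bsub>module_direct_sum J M\<^esub> f = f"
      using f unfolding mem ops by (auto simp: fun_eq_iff extensional_def)
  next
    fix f g assume fg: "f \<in> carrier (module_direct_sum J M)" "g \<in> carrier (module_direct_sum J M)"
    show "f \<oplus>\<^bsub>module_direct_sum J M\<^esub> g \<in> carrier (module_direct_sum J M)"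
      using fg fin_add unfolding mem ops by simp
    show "f \<oplus>\<^bsub>module_direct_sum J M\<^esub> g = g \<oplus>\<^bsub>module_direct_sum J M\<^esub> f"
      using fg abelian_monoid.a_comm[OF abelian_group.axioms(1)[OF ab]]
      unfolding mem ops by (auto simp: fun_eq_iff)
    fix h assume h: "h \<in> carrier (module_direct_sum J M)"
    show "f \<oplus>\<^bsub>module_direct_sum J M\<^esub> g \<oplus>\<^bsub>module_direct_sum J M\<^esub> h
        = f \<oplus>\<^bsub>module_direct_sum J M\<^esub> (g \<oplus>\<^bsub>module_direct_sum J M\<^esub> h)"
      using fg h abelian_monoid.a_assoc[OF abelian_group.axioms(1)[OF ab]]
      unfolding mem ops by (auto simp: fun_eq_iff)
  next
    show "\<zero>\<^bsub>module_direct_sum J M\<^esub> \<in> carrier (module_direct_sum J M)"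
      unfolding mem ops by simp
  qed
  then have "module K (module_direct_sum J M)"
  proof (rule moduleI[OF K.is_cring])
    fix a f assume af: "a \<in> carrier K" "f \<in> carrier (module_direct_sum J M)"
    then show "a \<odot>\<^bsub>module_direct_sum J M\<^esub> f \<in> carrier (module_direct_sum J M)"
      using fin_smult unfolding mem ops by simp
    fix b assume "b \<in> carrier K"
    with af show "(a \<oplus>\<^bsub>K\<^esub> b) \<odot>\<^bsub>module_direct_sum J M\<^esub> f
        = a \<odot>\<^bsub>module_direct_sum J M\<^esub> f \<oplus>\<^bsub>module_direct_sum J M\<^esub> b \<odot>\<^bsub>module_direct_sum J M\<^esub> f"
      and "(a \<otimes>\<^bsub>K\<^esub> b) \<odot>\<^bsub>module_direct_sum J M\<^esub> f
        = a \<odot>\<^bsub>module_direct_sum J M\<^esub> (b \<odot>\<^bsub>module_direct_sum J M\<^esub> f)"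
      using module.smult_l_distr[OF mod] module.smult_assoc1[OF mod]
      unfolding mem ops by (auto simp: fun_eq_iff)
  next
    fix a f g assume "a \<in> carrier K" "f \<in> carrier (module_direct_sum J M)"
      "g \<in> carrier (module_direct_sum J M)"
    then show "a \<odot>\<^bsub>module_direct_sum J M\<^esub> (f \<oplus>\<^bsub>module_direct_sum J M\<^esub> g)
        = a \<odot>\<^bsub>module_direct_sum J M\<^esub> f \<oplus>\<^bsub>module_direct_sum J M\<^esub> a \<odot>\<^bsub>module_direct_sum J M\<^esub> g"
      using module.smult_r_distr[OF mod] unfolding mem ops by (auto simp: fun_eq_iff)
  next
    fix f assume "f \<in> carrier (module_direct_sum J M)"
    then show "\<one>\<^bsub>K\<^esub> \<odot>\<^bsub>module_direct_sum J M\<^esub> f = f"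
      using module.smult_one[OF mod] unfolding mem ops by (auto simp: fun_eq_iff extensional_def)
  qed
  then show ?thesis using K by (simp add: vectorspace_def)
qed

lemma persistence_module_direct_sum:
  assumes K: "field K" and U: "\<And>j. j \<in> J \<Longrightarrow> persistence_module K (U j)"
  shows "persistence_module K (persistence_direct_sum J U)"
proof -
  have vs: "vectorspace K (pspace (persistence_direct_sum J U) t)" for t
    using K U by (auto simp: persistence_direct_sum_def persistence_module_def
        intro!: vectorspace_module_direct_sum)
  show ?thesis
  proof (rule persistence_module.intro)
    show "vectorspace K (pspace (persistence_direct_sum J U) t)" for t by (rule vs)
    show "linear_map K (pspace (persistence_direct_sum J U) s) (pspace (persistence_direct_sum J U) t)
            (pmap (persistence_direct_sum J U) t s)" if st: "s \<le> t" for s t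
    proof -
      have lin: "linear_map K (pspace (U j) s) (pspace (U j) t) (pmap (U j) t s)" if "j \<in> J" for j
        using U[OF that] st by (rule persistence_module.linear_map_pmap)
      then have hom: "mod_hom K (pspace (U j) s) (pspace (U j) t) (pmap (U j) t s)" if "j \<in> J" for j
        using that by (simp add: linear_map_def)
      have mh: "pmap (U j) t s \<in> module_hom K (pspace (U j) s) (pspace (U j) t)" if "j \<in> J" for j
        using hom[OF that] by (simp add: mod_hom_def mod_hom_axioms_def)
      have mod: "module K (pspace (U j) s)" if "j \<in> J" for j
        using hom[OF that] by (simp add: mod_hom_def)
      then have ab: "abelian_group (pspace (U j) s)" if "j \<in> J" for j
        using that by (simp add: module_def)
      have restrict_fin: "{j \<in> J. restrict h J j \<noteq> \<zero>\<^bsub>pspace (U j) t\<^esub>}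
          = {j \<in> J. h j \<noteq> \<zero>\<^bsub>pspace (U j) t\<^esub>}" for h
        by auto
      have fin: "finite {j \<in> J. pmap (U j) t s (f j) \<noteq> \<zero>\<^bsub>pspace (U j) t\<^esub>}"
        if "finite {j \<in> J. f j \<noteq> \<zero>\<^bsub>pspace (U j) s\<^esub>}" for f
        by (rule finite_subset[OF _ that]) (use mod_hom.f0_is_0[OF hom] in fastforce)
      have "pmap (persistence_direct_sum J U) t s
          \<in> module_hom K (pspace (persistence_direct_sum J U) s) (pspace (persistence_direct_sum J U) t)"
        using module_hom_closed[OF mh] module_hom_add[OF mh] module_hom_smult[OF mh] fin
          module.smult_closed[OF mod] abelian_groupE(1)[OF ab]
        unfolding module_hom_def[where M = "pspace (persistence_direct_sum J U) s"]
        by (auto simp: persistence_direct_sum_def module_direct_sum_mem module_direct_sum_simps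
            Pi_iff fun_eq_iff restrict_fin cong: conj_cong)
      then show ?thesis
        using vs[of s] vs[of t]
        by (simp add: linear_map_def mod_hom_def mod_hom_axioms_def vectorspace_def)
    qed
    show "pmap (persistence_direct_sum J U) t s (pmap (persistence_direct_sum J U) s r f)
        = pmap (persistence_direct_sum J U) t r f"
      if "r \<le> s" "s \<le> t" "f \<in> carrier (pspace (persistence_direct_sum J U) r)" for r s t f
      using that persistence_module.pmap_comp[OF U]
      by (auto simp: persistence_direct_sum_def module_direct_sum_mem fun_eq_iff)
    show "pmap (persistence_direct_sum J U) t t f = f"
      if "f \<in> carrier (pspace (persistence_direct_sum J U) t)" for t f
      using that persistence_module.pmap_refl[OF U]
      by (auto simp: persistence_direct_sum_def module_direct_sum_mem fun_eq_iff extensional_def)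
  qed
qed

end

theory Submission
  imports Defs
begin

text \<open>
  Each space \<open>V\<^sub>t\<close> carries two filtrations: by the images of the maps coming in from indices
  \<open>s \<le> t\<close>, and by the kernels of the maps going out to indices \<open>r \<ge> t\<close>. A cut of the index set into
  a lower and an upper part is recorded by its upper part, an upper set. A cut \<open>L\<close> that has \<open>t\<close> on its
  upper side gives the union \<open>im_minus L t\<close> of the images from below the cut and the intersection
  \<open>im_plus L t\<close> of the images from above it; a cut \<open>U\<close> that has \<open>t\<close> on its lower side gives
  \<open>ker_minus U t\<close> and \<open>ker_plus U t\<close> in the same way. An interval \<open>I\<close> is what lies between two
  such cuts, \<open>I = L - U\<close>, and the vectors that live exactly on \<open>I\<close> are measured at \<open>t \<in> I\<close> by the
  quotient of \<open>V_plus L U t\<close> by \<open>V_minus L U t\<close>.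

  The descending chain conditions say that an intersection of images is one of these images, and
  likewise for kernels. Therefore a structure map between two indices of \<open>I\<close> sends \<open>V_plus\<close> onto
  \<open>V_plus\<close> (\<open>V_plus_lift\<close>) and is injective modulo \<open>V_minus\<close> (\<open>V_minus_reflect\<close>), so the quotient is
  the same at all indices of \<open>I\<close>. A basis of the quotient at one index is spread over the whole of
  \<open>I\<close> by compatible families of vectors, called threads here (\<open>thread_through\<close>): to the right they
  are forced, and to the left preimages have to be chosen along a sequence that runs down to the
  lower end of \<open>I\<close>. This is a Mittag-Leffler argument, and it is where a countable dense set of
  indices is used: it provides such a sequence (\<open>coinitial_sequence\<close>).

  Fix \<open>t\<close>. The threads of all intervals through \<open>t\<close>, evaluated at \<open>t\<close>, form a basis of \<open>V\<^sub>t\<close>.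
  They span (\<open>spans_from_intervals\<close>): for a proper subspace \<open>X\<close> let \<open>L\<close> be the cut at which the
  images stop being contained in \<open>X\<close>, and then \<open>U\<close> the cut at which the kernels inside
  \<open>im_plus L t\<close> stop being contained in \<open>X\<close>. By construction \<open>X\<close> contains \<open>V_minus L U t\<close> but not
  \<open>V_plus L U t\<close>, so it misses a thread of \<open>L - U\<close>. They are independent
  (\<open>indep_from_intervals\<close>): in a linear relation take the interval whose pair of cuts is
  lexicographically last; all terms from other intervals are absorbed by
  \<open>im_minus L t + (im_plus L t \<inter> ker_minus U t)\<close>, so the terms from this interval add up to an element
  of \<open>V_minus L U t\<close>, against their independence modulo \<open>V_minus L U t\<close>.

  A thread of \<open>I = L - U\<close> is killed by the maps that leave \<open>I\<close>, because its vectors lie in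
  \<open>ker_plus U\<close>. It therefore spans a copy of the interval module of \<open>I\<close>, and taking coordinates
  with respect to the threads is the desired isomorphism (\<open>isomorphic_to_interval_sum\<close>).
\<close>

section \<open>Bases modulo a subspace\<close>

text \<open>
  Linear independence of the family \<open>e\<close> in the quotient by \<open>N\<close>, without forming the quotient.
  Families rather than sets of vectors are needed because the same index set \<open>B\<close> will serve at
  all indices of an interval.
\<close>

definition indep_mod ::
    "('k, 'c) ring_scheme \<Rightarrow> ('k, 'v, 'm) module_scheme \<Rightarrow> 'v set \<Rightarrow> ('j \<Rightarrow> 'v) \<Rightarrow> 'j set \<Rightarrow> bool" where
  "indep_mod K M N e B \<longleftrightarrow>
     (\<forall>F c. finite F \<and> F \<subseteq> B \<and> c \<in> F \<rightarrow> carrier K \<and> (\<Oplus>\<^bsub>M\<^esub>j\<in>F. c j \<odot>\<^bsub>M\<^esub> e j) \<in> N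
        \<longrightarrow> (\<forall>j\<in>F. c j = \<zero>\<^bsub>K\<^esub>))"

text \<open>
  \<open>P\<close> is contained in the sum of \<open>N\<close> and the span of the family. Testing against all submodules
  avoids writing down coefficients, so that this property can be carried along a linear map by
  taking images and preimages of submodules.
\<close>

definition spans_mod ::
    "('k, 'c) ring_scheme \<Rightarrow> ('k, 'v, 'm) module_scheme \<Rightarrow> 'v set \<Rightarrow> ('j \<Rightarrow> 'v) \<Rightarrow> 'j set \<Rightarrow> 'v set \<Rightarrow> bool" where
  "spans_mod K M N e B P \<longleftrightarrow> (\<forall>X. submodule K X M \<and> N \<subseteq> X \<and> e ` B \<subseteq> X \<longrightarrow> P \<subseteq> X)"

lemma indep_modD:
  assumes "indep_mod K M N e B" "finite F" "F \<subseteq> B" "c \<in> F \<rightarrow> carrier K"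
    and "(\<Oplus>\<^bsub>M\<^esub>j\<in>F. c j \<odot>\<^bsub>M\<^esub> e j) \<in> N" "j \<in> F"
  shows "c j = \<zero>\<^bsub>K\<^esub>"
  using assms by (simp add: indep_mod_def)

lemma spans_mod_cong:
  assumes "\<And>j. j \<in> B \<Longrightarrow> e j = f j"
  shows "spans_mod K M N e B P = spans_mod K M N f B P"
proof -
  have "e ` B = f ` B" using assms by auto
  then show ?thesis by (simp add: spans_mod_def)
qed

context module
begin

lemma submodule_subset: "submodule R X M \<Longrightarrow> x \<in> X \<Longrightarrow> x \<in> carrier M"
  by (auto simp: submodule_def)

lemma submodule_zero_mem: "submodule R X M \<Longrightarrow> \<zero>\<^bsub>M\<^esub> \<in> X"
  by (simp add: submodule_def)

lemma submodule_add: "submodule R X M \<Longrightarrow> x \<in> X \<Longrightarrow> y \<in> X \<Longrightarrow> x \<oplus>\<^bsub>M\<^esub> y \<in> X"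
  by (simp add: submodule_def)

lemma submodule_smult: "submodule R X M \<Longrightarrow> a \<in> carrier R \<Longrightarrow> x \<in> X \<Longrightarrow> a \<odot>\<^bsub>M\<^esub> x \<in> X"
  by (simp add: submodule_def)

lemma submodule_neg: assumes "submodule R X M" "x \<in> X" shows "\<ominus>\<^bsub>M\<^esub> x \<in> X"
proof -
  have "(\<ominus> \<one>) \<odot>\<^bsub>M\<^esub> x = \<ominus>\<^bsub>M\<^esub> x"
    using assms by (intro smult_minus_1) (rule submodule_subset)
  with submodule_smult[OF assms(1) _ assms(2), of "\<ominus> \<one>"] show ?thesis by simp
qed

lemma submodule_diff: "submodule R X M \<Longrightarrow> x \<in> X \<Longrightarrow> y \<in> X \<Longrightarrow> x \<ominus>\<^bsub>M\<^esub> y \<in> X"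
  by (simp add: a_minus_def submodule_add submodule_neg)

lemma diff_add_cancel: "x \<in> carrier M \<Longrightarrow> y \<in> carrier M \<Longrightarrow> (x \<ominus>\<^bsub>M\<^esub> y) \<oplus>\<^bsub>M\<^esub> y = x"
  by (simp add: a_minus_def M.a_assoc M.l_neg)

lemma submodule_Int: "submodule R X M \<Longrightarrow> submodule R Y M \<Longrightarrow> submodule R (X \<inter> Y) M"
  by (auto simp: submodule_def)

lemma submodule_finsum:
  assumes X: "submodule R X M" and F: "finite F" "\<And>j. j \<in> F \<Longrightarrow> f j \<in> X"
  shows "finsum M f F \<in> X"
  using F
proof (induction F rule: finite_induct)
  case empty
  then show ?case by (simp add: submodule_zero_mem[OF X])
next
  case (insert a F)
  then show ?case
    using submodule_subset[OF X] by (subst finsum_insert) (auto intro: submodule_add[OF X])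
qed

lemma mem_submodule_sum: "x \<in> submodule_sum A B \<longleftrightarrow> (\<exists>a\<in>A. \<exists>b\<in>B. x = a \<oplus>\<^bsub>M\<^esub> b)"
  by (auto simp: submodule_sum_def)

lemma finsum_split:
  assumes "finite F" "\<And>j. j \<in> F \<Longrightarrow> f j \<in> carrier M"
  shows "finsum M f F = finsum M f {j \<in> F. P j} \<oplus>\<^bsub>M\<^esub> finsum M f {j \<in> F. \<not> P j}"
proof -
  have "F = {j \<in> F. P j} \<union> {j \<in> F. \<not> P j}" by auto
  then have "finsum M f F = finsum M f ({j \<in> F. P j} \<union> {j \<in> F. \<not> P j})" by simp
  also have "\<dots> = finsum M f {j \<in> F. P j} \<oplus>\<^bsub>M\<^esub> finsum M f {j \<in> F. \<not> P j}"
    using assms by (intro finsum_Un_disjoint) auto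
  finally show ?thesis .
qed

lemma indep_mod_cong:
  assumes "\<And>j. j \<in> B \<Longrightarrow> e j = f j" "\<And>j. j \<in> B \<Longrightarrow> f j \<in> carrier M"
  shows "indep_mod R M N e B = indep_mod R M N f B"
proof -
  have "(\<Oplus>\<^bsub>M\<^esub>j\<in>F. c j \<odot>\<^bsub>M\<^esub> e j) = (\<Oplus>\<^bsub>M\<^esub>j\<in>F. c j \<odot>\<^bsub>M\<^esub> f j)"
    if "F \<subseteq> B" "c \<in> F \<rightarrow> carrier R" for F c
    using assms that by (intro M.finsum_cong') (auto intro!: smult_closed)
  then show ?thesis unfolding indep_mod_def by (metis (no_types, lifting))
qed

end

context vectorspace
begin

lemma submodule_smult_cancel:
  assumes X: "submodule K X V" and a: "a \<in> carrier K" "a \<noteq> \<zero>\<^bsub>K\<^esub>" and x: "x \<in> carrier V"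
    and ax: "a \<odot>\<^bsub>V\<^esub> x \<in> X"
  shows "x \<in> X"
proof -
  have u: "a \<in> Units K" using a by (simp add: field_Units)
  then have "x = inv\<^bsub>K\<^esub> a \<odot>\<^bsub>V\<^esub> (a \<odot>\<^bsub>V\<^esub> x)"
    using x a by (simp flip: smult_assoc1)
  with submodule_smult[OF X Units_inv_closed[OF u] ax] show ?thesis by simp
qed

text \<open>
  A maximal subset of \<open>P\<close> that is independent modulo \<open>N\<close> also spans \<open>P\<close> modulo \<open>N\<close>: a further vector of
  \<open>P\<close> satisfies a relation modulo \<open>N\<close> with the subset, in which its own coefficient is invertible.
\<close>

lemma exists_basis_mod:
  assumes P: "P \<subseteq> carrier V"
  shows "\<exists>B\<subseteq>P. indep_mod K V N (\<lambda>b. b) B \<and> spans_mod K V N (\<lambda>b. b) B P"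
proof -
  let ?A = "{B. B \<subseteq> P \<and> indep_mod K V N (\<lambda>b. b) B}"
  have "\<exists>B\<in>?A. \<forall>Y\<in>?A. B \<subseteq> Y \<longrightarrow> Y = B"
  proof (rule subset_Zorn_nonempty)
    have "{} \<in> ?A" by (simp add: indep_mod_def)
    then show "?A \<noteq> {}" by blast
  next
    fix C assume C: "C \<noteq> {}" "subset.chain ?A C"
    have "indep_mod K V N (\<lambda>b. b) (\<Union>C)"
      unfolding indep_mod_def
    proof (intro allI impI, elim conjE)
      fix F c assume F: "finite F" "F \<subseteq> \<Union>C" "c \<in> F \<rightarrow> carrier K" "(\<Oplus>\<^bsub>V\<^esub>j\<in>F. c j \<odot>\<^bsub>V\<^esub> j) \<in> N"
      obtain B where "B \<in> C" "F \<subseteq> B"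
        using finite_subset_Union_chain[OF F(1,2) C] by blast
      moreover have "C \<subseteq> ?A" using C(2) by (simp add: subset_chain_def)
      then have "indep_mod K V N (\<lambda>b. b) B" using \<open>B \<in> C\<close> by blast
      ultimately show "\<forall>j\<in>F. c j = \<zero>\<^bsub>K\<^esub>" using F unfolding indep_mod_def by blast
    qed
    moreover have "\<Union>C \<subseteq> P" using C by (auto simp: subset_chain_def)
    ultimately show "\<Union>C \<in> ?A" by simp
  qed
  then obtain B where B: "B \<in> ?A" "\<forall>Y\<in>?A. B \<subseteq> Y \<longrightarrow> Y = B" by (elim bexE)
  then have BP: "B \<subseteq> P" and ind: "indep_mod K V N (\<lambda>b. b) B" by simp_all
  have max: "Y = B" if "Y \<subseteq> P" "indep_mod K V N (\<lambda>b. b) Y" "B \<subseteq> Y" for Y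
    using B(2) that by simp
  have Pc: "x \<in> carrier V" if "x \<in> P" for x using that P by blast
  have "P \<subseteq> X" if X: "submodule K X V" and NX: "N \<subseteq> X" and BX: "B \<subseteq> X" for X
  proof
    fix p assume p: "p \<in> P"
    show "p \<in> X"
    proof (cases "p \<in> B")
      case True
      then show ?thesis using BX by blast
    next
      case False
      then have "\<not> indep_mod K V N (\<lambda>b. b) (insert p B)"
        using max[of "insert p B"] p BP by blast
      then obtain F c k where F: "finite F" "F \<subseteq> insert p B" "c \<in> F \<rightarrow> carrier K"
          and N: "(\<Oplus>\<^bsub>V\<^esub>j\<in>F. c j \<odot>\<^bsub>V\<^esub> j) \<in> N" and k: "k \<in> F" "c k \<noteq> \<zero>\<^bsub>K\<^esub>"
        unfolding indep_mod_def by blast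
      have mem: "c j \<odot>\<^bsub>V\<^esub> j \<in> carrier V" if "j \<in> F" for j
        using that F p BP Pc by (auto intro!: smult_closed)
      let ?G = "F - {p}"
      have G: "finite ?G" "?G \<subseteq> B" "c \<in> ?G \<rightarrow> carrier K" using F by auto
      have cG: "(\<Oplus>\<^bsub>V\<^esub>j\<in>?G. c j \<odot>\<^bsub>V\<^esub> j) \<in> carrier V"
        using mem by (intro finsum_closed) auto
      have pF: "p \<in> F"
      proof (rule ccontr)
        assume "p \<notin> F"
        then have "F \<subseteq> B" using F by blast
        then show False using ind F N k unfolding indep_mod_def by blast
      qed
      then have split: "(\<Oplus>\<^bsub>V\<^esub>j\<in>F. c j \<odot>\<^bsub>V\<^esub> j) = c p \<odot>\<^bsub>V\<^esub> p \<oplus>\<^bsub>V\<^esub> (\<Oplus>\<^bsub>V\<^esub>j\<in>?G. c j \<odot>\<^bsub>V\<^esub> j)"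
        using finsum_insert[of ?G p "\<lambda>j. c j \<odot>\<^bsub>V\<^esub> j"] F mem by (auto simp: insert_absorb)
      have cp: "c p \<noteq> \<zero>\<^bsub>K\<^esub>"
      proof
        assume 0: "c p = \<zero>\<^bsub>K\<^esub>"
        then have "(\<Oplus>\<^bsub>V\<^esub>j\<in>?G. c j \<odot>\<^bsub>V\<^esub> j) \<in> N"
          using N split cG Pc[OF p] by simp
        then have "\<forall>j\<in>?G. c j = \<zero>\<^bsub>K\<^esub>" using ind G unfolding indep_mod_def by blast
        then show False using k 0 by blast
      qed
      have "(\<Oplus>\<^bsub>V\<^esub>j\<in>?G. c j \<odot>\<^bsub>V\<^esub> j) \<in> X"
        using G BX by (intro submodule_finsum[OF X] submodule_smult[OF X]) auto
      then have "(\<Oplus>\<^bsub>V\<^esub>j\<in>F. c j \<odot>\<^bsub>V\<^esub> j) \<ominus>\<^bsub>V\<^esub> (\<Oplus>\<^bsub>V\<^esub>j\<in>?G. c j \<odot>\<^bsub>V\<^esub> j) \<in> X"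
        using N NX by (intro submodule_diff[OF X]) auto
      moreover have "(\<Oplus>\<^bsub>V\<^esub>j\<in>F. c j \<odot>\<^bsub>V\<^esub> j) \<ominus>\<^bsub>V\<^esub> (\<Oplus>\<^bsub>V\<^esub>j\<in>?G. c j \<odot>\<^bsub>V\<^esub> j) = c p \<odot>\<^bsub>V\<^esub> p"
        unfolding split using mem[OF pF] cG by (simp add: a_minus_def M.a_assoc M.r_neg)
      ultimately have "c p \<odot>\<^bsub>V\<^esub> p \<in> X" by simp
      moreover have "c p \<in> carrier K" using F(3) pF by (rule Pi_mem)
      ultimately show ?thesis by (intro submodule_smult_cancel[OF X _ cp Pc[OF p]])
    qed
  qed
  then have "spans_mod K V N (\<lambda>b. b) B P" by (simp add: spans_mod_def)
  with BP ind show ?thesis by blast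
qed

end


section \<open>Images and kernels at a cut\<close>

definition upper_set :: "'r::order set \<Rightarrow> bool" where
  "upper_set L \<longleftrightarrow> (\<forall>s\<in>L. \<forall>t. s \<le> t \<longrightarrow> t \<in> L)"

lemma upper_setD: "upper_set L \<Longrightarrow> s \<in> L \<Longrightarrow> s \<le> t \<Longrightarrow> t \<in> L"
  by (auto simp: upper_set_def)

lemma upper_set_less: "upper_set L \<Longrightarrow> s \<in> L \<Longrightarrow> (r::'r::linorder) \<notin> L \<Longrightarrow> r < s"
  by (meson not_le upper_setD)

sublocale persistence_module \<subseteq> sp: vectorspace K "pspace V t" for t
  by (rule vectorspace_pspace)

context persistence_module
begin

abbreviation C :: "'r \<Rightarrow> 'v set" where
  "C t \<equiv> carrier (pspace V t)"

abbreviation Z :: "'r \<Rightarrow> 'v" where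
  "Z t \<equiv> \<zero>\<^bsub>pspace V t\<^esub>"

lemma mod_hom_pmap: "s \<le> t \<Longrightarrow> mod_hom K (pspace V s) (pspace V t) (pmap V t s)"
  using linear_map_pmap[of s t] by (simp add: linear_map_def)

lemma pmap_closed [simp]: "s \<le> t \<Longrightarrow> x \<in> C s \<Longrightarrow> pmap V t s x \<in> C t"
  using mod_hom.f_im[OF mod_hom_pmap] by blast

lemma pmap_zero [simp]: "s \<le> t \<Longrightarrow> pmap V t s (Z s) = Z t"
  using mod_hom.f0_is_0[OF mod_hom_pmap] by blast

lemma pmap_add: "s \<le> t \<Longrightarrow> x \<in> C s \<Longrightarrow> y \<in> C s \<Longrightarrow>
    pmap V t s (x \<oplus>\<^bsub>pspace V s\<^esub> y) = pmap V t s x \<oplus>\<^bsub>pspace V t\<^esub> pmap V t s y"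
  using module_hom_add[OF mod_hom.f_hom[OF mod_hom_pmap]] by blast

lemma pmap_diff: "s \<le> t \<Longrightarrow> x \<in> C s \<Longrightarrow> y \<in> C s \<Longrightarrow>
    pmap V t s (x \<ominus>\<^bsub>pspace V s\<^esub> y) = pmap V t s x \<ominus>\<^bsub>pspace V t\<^esub> pmap V t s y"
  using mod_hom.f_minus[OF mod_hom_pmap] by blast

lemma pmap_smult: "s \<le> t \<Longrightarrow> a \<in> carrier K \<Longrightarrow> x \<in> C s \<Longrightarrow>
    pmap V t s (a \<odot>\<^bsub>pspace V s\<^esub> x) = a \<odot>\<^bsub>pspace V t\<^esub> pmap V t s x"
  using module_hom_smult[OF mod_hom.f_hom[OF mod_hom_pmap]] by blast

lemma pmap_comb:
  assumes st: "s \<le> t" and F: "finite F" "\<And>j. j \<in> F \<Longrightarrow> c j \<in> carrier K" "\<And>j. j \<in> F \<Longrightarrow> e j \<in> C s"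
  shows "pmap V t s (\<Oplus>\<^bsub>pspace V s\<^esub>j\<in>F. c j \<odot>\<^bsub>pspace V s\<^esub> e j)
       = (\<Oplus>\<^bsub>pspace V t\<^esub>j\<in>F. c j \<odot>\<^bsub>pspace V t\<^esub> pmap V t s (e j))"
  using F
proof (induction F rule: finite_induct)
  case empty
  then show ?case using st by simp
next
  case (insert j F)
  then have cl: "c i \<odot>\<^bsub>pspace V s\<^esub> e i \<in> C s" "c i \<odot>\<^bsub>pspace V t\<^esub> pmap V t s (e i) \<in> C t"
    if "i \<in> insert j F" for i
    using that st by simp_all
  have "(\<Oplus>\<^bsub>pspace V s\<^esub>i\<in>F. c i \<odot>\<^bsub>pspace V s\<^esub> e i) \<in> C s"
    using cl by (intro sp.M.finsum_closed) auto
  with insert cl st show ?case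
    by (simp add: Pi_def pmap_add pmap_smult)
qed

text \<open>
  In the next four definitions the complement of \<open>L\<close> or \<open>U\<close> is the lower part of the cut.
  Zero is put into \<open>im_minus\<close> explicitly since the lower part of the cut \<open>L\<close> may be empty; for
  \<open>ker_minus\<close> the index \<open>r = t\<close> provides it as soon as \<open>t \<notin> U\<close>. If \<open>U\<close> is empty, then \<open>ker_plus U t\<close>
  is the whole space.
\<close>

definition im_plus :: "'r set \<Rightarrow> 'r \<Rightarrow> 'v set" where
  "im_plus L t = {x \<in> C t. \<forall>s\<in>L. s \<le> t \<longrightarrow> x \<in> pmap V t s ` C s}"

definition im_minus :: "'r set \<Rightarrow> 'r \<Rightarrow> 'v set" where
  "im_minus L t = {x. x = Z t \<or> (\<exists>s. s \<notin> L \<and> s \<le> t \<and> x \<in> pmap V t s ` C s)}"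

definition ker_plus :: "'r set \<Rightarrow> 'r \<Rightarrow> 'v set" where
  "ker_plus U t = {x \<in> C t. \<forall>r\<in>U. t \<le> r \<longrightarrow> pmap V r t x = Z r}"

definition ker_minus :: "'r set \<Rightarrow> 'r \<Rightarrow> 'v set" where
  "ker_minus U t = {x \<in> C t. \<exists>r. r \<notin> U \<and> t \<le> r \<and> pmap V r t x = Z r}"

definition V_plus :: "'r set \<Rightarrow> 'r set \<Rightarrow> 'r \<Rightarrow> 'v set" where
  "V_plus L U t = im_plus L t \<inter> ker_plus U t"

text \<open>
  The vectors of \<open>V_plus L U t\<close> that are sums of one that comes from before \<open>L\<close> and one that
  vanishes before \<open>U\<close>.
\<close>

definition V_minus :: "'r set \<Rightarrow> 'r set \<Rightarrow> 'r \<Rightarrow> 'v set" where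
  "V_minus L U t =
     sp.submodule_sum t (im_minus L t \<inter> ker_plus U t) (im_plus L t \<inter> ker_minus U t)"

lemma image_mono:
  assumes "r \<le> s" "s \<le> t"
  shows "pmap V t r ` C r \<subseteq> pmap V t s ` C s"
proof
  fix x assume "x \<in> pmap V t r ` C r"
  then obtain y where y: "y \<in> C r" "x = pmap V t r y" by blast
  then have "x = pmap V t s (pmap V s r y)" using assms pmap_comp by simp
  then show "x \<in> pmap V t s ` C s" using y assms by simp
qed

lemma kernel_mono:
  assumes "t \<le> r" "r \<le> r'" "x \<in> C t" "pmap V r t x = Z r"
  shows "pmap V r' t x = Z r'"
  using pmap_comp[OF assms(1,2,3)] assms by simp

lemma submodule_image: "s \<le> t \<Longrightarrow> submodule K (pmap V t s ` C s) (pspace V t)"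
  using mod_hom.im_is_submodule[OF mod_hom_pmap] mod_hom.im_def[OF mod_hom_pmap] by metis

lemma submodule_im_plus: "submodule K (im_plus L t) (pspace V t)"
  unfolding submodule_def im_plus_def
  using sp.submodule_add[OF submodule_image] sp.submodule_smult[OF submodule_image]
    sp.submodule_zero_mem[OF submodule_image]
  by (auto simp: sp.module_axioms)

lemma submodule_im_minus: "submodule K (im_minus L t) (pspace V t)"
proof -
  have sub: "im_minus L t \<subseteq> C t"
    by (auto simp: im_minus_def)
  have add: "x \<oplus>\<^bsub>pspace V t\<^esub> y \<in> im_minus L t" if x: "x \<in> im_minus L t" and y: "y \<in> im_minus L t" for x y
  proof (cases "x = Z t \<or> y = Z t")
    case True
    then show ?thesis using that sub by auto
  next
    case False
    then obtain s s' where s: "s \<notin> L" "s \<le> t" "x \<in> pmap V t s ` C s"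
      and s': "s' \<notin> L" "s' \<le> t" "y \<in> pmap V t s' ` C s'"
      using x y by (auto simp: im_minus_def)
    have "max s s' \<notin> L" "max s s' \<le> t" using s s' by (auto simp: max_def)
    moreover have "x \<in> pmap V t (max s s') ` C (max s s')" "y \<in> pmap V t (max s s') ` C (max s s')"
      using image_mono[of s "max s s'" t] image_mono[of s' "max s s'" t] s s' by auto
    ultimately show ?thesis
      using sp.submodule_add[OF submodule_image[of "max s s'" t]] unfolding im_minus_def by blast
  qed
  have "a \<odot>\<^bsub>pspace V t\<^esub> x \<in> im_minus L t" if "a \<in> carrier K" "x \<in> im_minus L t" for a x
    using that sp.submodule_smult[OF submodule_image] unfolding im_minus_def by auto
  with sub add show ?thesis
    unfolding submodule_def by (auto simp: sp.module_axioms im_minus_def)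
qed

lemma submodule_ker_plus: "submodule K (ker_plus U t) (pspace V t)"
  unfolding submodule_def ker_plus_def
  by (auto simp: sp.module_axioms pmap_add pmap_smult)

lemma submodule_ker_minus:
  assumes "t \<notin> U"
  shows "submodule K (ker_minus U t) (pspace V t)"
proof -
  have "x \<oplus>\<^bsub>pspace V t\<^esub> y \<in> ker_minus U t" if "x \<in> ker_minus U t" "y \<in> ker_minus U t" for x y
  proof -
    from that obtain r r' where r: "r \<notin> U" "t \<le> r" "x \<in> C t" "pmap V r t x = Z r"
      and r': "r' \<notin> U" "t \<le> r'" "y \<in> C t" "pmap V r' t y = Z r'"
      by (auto simp: ker_minus_def)
    have "max r r' \<notin> U" "t \<le> max r r'" using r r' by (auto simp: max_def)
    moreover have "pmap V (max r r') t x = Z (max r r')" "pmap V (max r r') t y = Z (max r r')"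
      using kernel_mono[of t r "max r r'"] kernel_mono[of t r' "max r r'"] r r' by auto
    ultimately show ?thesis
      using r r' unfolding ker_minus_def
      by (auto intro!: exI[of _ "max r r'"] simp: pmap_add simp del: max.bounded_iff)
  qed
  moreover have "a \<odot>\<^bsub>pspace V t\<^esub> x \<in> ker_minus U t" if "a \<in> carrier K" "x \<in> ker_minus U t" for a x
    using that unfolding ker_minus_def by (auto simp: pmap_smult)
  moreover have "Z t \<in> ker_minus U t"
    using assms by (auto simp: ker_minus_def)
  ultimately show ?thesis
    unfolding submodule_def by (auto simp: sp.module_axioms ker_minus_def)
qed

lemma submodule_V_plus: "submodule K (V_plus L U t) (pspace V t)"
  unfolding V_plus_def by (intro sp.submodule_Int submodule_im_plus submodule_ker_plus)

lemma submodule_V_minus: "t \<notin> U \<Longrightarrow> submodule K (V_minus L U t) (pspace V t)"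
  unfolding V_minus_def
  by (intro sp.sum_is_submodule sp.submodule_Int submodule_im_plus submodule_ker_plus
      submodule_im_minus submodule_ker_minus)

lemma im_minus_subset_image:
  assumes "upper_set L" "s \<in> L" "s \<le> t"
  shows "im_minus L t \<subseteq> pmap V t s ` C s"
proof
  fix x assume "x \<in> im_minus L t"
  then consider "x = Z t" | r where "r \<notin> L" "r \<le> t" "x \<in> pmap V t r ` C r"
    by (auto simp: im_minus_def)
  then show "x \<in> pmap V t s ` C s"
  proof cases
    case 1
    then show ?thesis using sp.submodule_zero_mem[OF submodule_image[OF assms(3)]] by simp
  next
    case 2
    then have "r \<le> s" using upper_set_less[OF assms(1,2)] by force
    then show ?thesis using image_mono[of r s t] 2 assms(3) by blast
  qed
qed

lemma im_minus_subset_im_plus: "upper_set L \<Longrightarrow> im_minus L t \<subseteq> im_plus L t"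
  using im_minus_subset_image[of L _ t] sp.submodule_subset[OF submodule_im_minus[of L t]]
  by (auto simp: im_plus_def)

lemma ker_minus_subset_ker_plus:
  assumes U: "upper_set U"
  shows "ker_minus U t \<subseteq> ker_plus U t"
proof
  fix x assume "x \<in> ker_minus U t"
  then obtain r where r: "x \<in> C t" "r \<notin> U" "t \<le> r" "pmap V r t x = Z r"
    by (auto simp: ker_minus_def)
  have "pmap V r' t x = Z r'" if "r' \<in> U" for r'
    using upper_set_less[OF U that r(2)] by (intro kernel_mono[OF r(3) _ r(1,4)]) simp
  with r(1) show "x \<in> ker_plus U t" by (simp add: ker_plus_def)
qed

lemma im_plus_push:
  assumes st: "s \<le> t" and y: "y \<in> im_plus L s"
  shows "pmap V t s y \<in> im_plus L t"
  unfolding im_plus_def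
proof (intro CollectI conjI ballI impI)
  have yC: "y \<in> C s" using y by (simp add: im_plus_def)
  then show "pmap V t s y \<in> C t" using st by simp
  fix r assume r: "r \<in> L" "r \<le> t"
  show "pmap V t s y \<in> pmap V t r ` C r"
  proof (cases "r \<le> s")
    case True
    then obtain z where "z \<in> C r" "y = pmap V s r z" using y r by (auto simp: im_plus_def)
    then show ?thesis using pmap_comp True st by auto
  next
    case False
    then have "s \<le> r" by simp
    then show ?thesis using image_mono[of s r t] yC r by blast
  qed
qed

lemma im_minus_push:
  assumes st: "s \<le> t" and y: "y \<in> im_minus L s"
  shows "pmap V t s y \<in> im_minus L t"
proof -
  consider "y = Z s" | r z where "r \<notin> L" "r \<le> s" "z \<in> C r" "y = pmap V s r z"
    using y by (auto simp: im_minus_def)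
  then show ?thesis
  proof cases
    case 1
    then show ?thesis using st by (simp add: im_minus_def)
  next
    case 2
    then have "pmap V t s y = pmap V t r z" "r \<le> t" using pmap_comp st by auto
    with 2 show ?thesis by (auto simp: im_minus_def)
  qed
qed

lemma ker_plus_pmap_iff:
  assumes "upper_set U" "s \<le> t" "t \<notin> U" "x \<in> C s"
  shows "pmap V t s x \<in> ker_plus U t \<longleftrightarrow> x \<in> ker_plus U s"
proof -
  have "t \<le> r" if "r \<in> U" for r using upper_set_less[OF assms(1) that assms(3)] by simp
  then show ?thesis using assms pmap_comp[OF assms(2) _ assms(4)] order_trans[OF assms(2)]
    by (auto simp: ker_plus_def)
qed

lemma ker_minus_pmap_iff:
  assumes "s \<le> t" "t \<notin> U" "x \<in> C s"
  shows "pmap V t s x \<in> ker_minus U t \<longleftrightarrow> x \<in> ker_minus U s"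
proof
  assume "pmap V t s x \<in> ker_minus U t"
  then show "x \<in> ker_minus U s"
    using assms pmap_comp[OF assms(1) _ assms(3)] order_trans[OF assms(1)]
    by (auto simp: ker_minus_def)
next
  assume "x \<in> ker_minus U s"
  then obtain r where r: "r \<notin> U" "s \<le> r" "pmap V r s x = Z r"
    by (auto simp: ker_minus_def)
  have "pmap V (max r t) s x = Z (max r t)"
    using kernel_mono[of s r "max r t" x] r assms by simp
  then have "pmap V (max r t) t (pmap V t s x) = Z (max r t)"
    using pmap_comp[of s t "max r t" x] assms by simp
  moreover have "max r t \<notin> U" using r assms by (simp add: max_def)
  ultimately show "pmap V t s x \<in> ker_minus U t"
    using assms unfolding ker_minus_def by (intro CollectI conjI exI[of _ "max r t"]) auto
qed

text \<open>
  The indices below the cut lie below \<open>s\<close> as well, so an image from there factors through \<open>s\<close>.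
\<close>

lemma im_minus_lift:
  assumes "upper_set L" "s \<in> L" "s \<le> t" "x \<in> im_minus L t"
  shows "\<exists>y\<in>im_minus L s. pmap V t s y = x"
proof -
  consider "x = Z t" | r z where "r \<notin> L" "r \<le> t" "z \<in> C r" "x = pmap V t r z"
    using assms(4) by (auto simp: im_minus_def)
  then show ?thesis
  proof cases
    case 1
    then show ?thesis using assms by (intro bexI[of _ "Z s"]) (auto simp: im_minus_def)
  next
    case 2
    then have "r \<le> s" using upper_set_less[OF assms(1,2)] by force
    then show ?thesis using 2 pmap_comp[of r s t z] assms
      by (intro bexI[of _ "pmap V s r z"]) (auto simp: im_minus_def)
  qed
qed

lemma V_plus_push:
  assumes "upper_set U" "s \<le> t" "t \<notin> U" "x \<in> V_plus L U s"
  shows "pmap V t s x \<in> V_plus L U t"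
  using assms im_plus_push ker_plus_pmap_iff sp.submodule_subset[OF submodule_im_plus]
  unfolding V_plus_def by blast

lemma V_minus_push:
  assumes "upper_set U" "s \<le> t" "t \<notin> U" "x \<in> V_minus L U s"
  shows "pmap V t s x \<in> V_minus L U t"
proof -
  obtain a b where x: "x = a \<oplus>\<^bsub>pspace V s\<^esub> b"
    and a: "a \<in> im_minus L s" "a \<in> ker_plus U s" and b: "b \<in> im_plus L s" "b \<in> ker_minus U s"
    using assms(4) by (auto simp: V_minus_def sp.mem_submodule_sum)
  have C: "a \<in> C s" "b \<in> C s"
    using a b by (auto simp: ker_plus_def ker_minus_def)
  have "pmap V t s x = pmap V t s a \<oplus>\<^bsub>pspace V t\<^esub> pmap V t s b"
    using x C assms by (simp add: pmap_add)
  moreover have "pmap V t s a \<in> im_minus L t \<inter> ker_plus U t"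
    using a im_minus_push ker_plus_pmap_iff assms C by blast
  moreover have "pmap V t s b \<in> im_plus L t \<inter> ker_minus U t"
    using b im_plus_push ker_minus_pmap_iff assms C by blast
  ultimately show ?thesis unfolding V_minus_def sp.mem_submodule_sum by blast
qed

text \<open>
  Otherwise every index in \<open>A\<close> could be followed by a smaller one with a different image, which
  produces a chain of images that never becomes constant.
\<close>

lemma smallest_image:
  assumes dcc: "dcc_images V" and A: "A \<noteq> {}" "\<And>s. s \<in> A \<Longrightarrow> s \<le> t"
  shows "\<exists>s\<in>A. \<forall>s'\<in>A. pmap V t s ` C s \<subseteq> pmap V t s' ` C s'"
proof (rule ccontr)
  assume "\<not> ?thesis"
  then have *: "\<exists>s'. s' \<in> A \<and> \<not> pmap V t s ` C s \<subseteq> pmap V t s' ` C s'" if "s \<in> A" for s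
    using that by blast
  have "\<exists>s'. s' \<in> A \<and> (s' < s \<and> pmap V t s' ` C s' \<noteq> pmap V t s ` C s)" if s: "s \<in> A" for s
  proof -
    obtain s' where s': "s' \<in> A" "\<not> pmap V t s ` C s \<subseteq> pmap V t s' ` C s'" using *[OF s] by blast
    then have "s' < s" using image_mono[of s s' t] A(2)[of s'] by force
    with s' show ?thesis by auto
  qed
  with A(1) obtain f where f: "\<And>n. f n \<in> A"
      "\<And>n. f (Suc n) < f n \<and> pmap V t (f (Suc n)) ` C (f (Suc n)) \<noteq> pmap V t (f n) ` C (f n)"
    using dependent_nat_choice[of "\<lambda>_ s. s \<in> A"
        "\<lambda>_ s s'. s' < s \<and> pmap V t s' ` C s' \<noteq> pmap V t s ` C s"] by blast
  then have "\<exists>N. \<forall>n\<ge>N. pmap V t (f n) ` C (f n) = pmap V t (f N) ` C (f N)"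
    using dcc A(2)[OF f(1)] unfolding dcc_images_def by blast
  then show False using f(2) by (meson le_SucI order_refl)
qed

lemma smallest_kernel:
  assumes dcc: "dcc_kernels V" and A: "A \<noteq> {}" "\<And>r. r \<in> A \<Longrightarrow> t \<le> r"
  shows "\<exists>r\<in>A. \<forall>r'\<in>A. \<forall>x\<in>C t. pmap V r t x = Z r \<longrightarrow> pmap V r' t x = Z r'"
proof (rule ccontr)
  define k where "k r = {x \<in> C t. pmap V r t x = Z r}" for r
  assume "\<not> ?thesis"
  then have "\<exists>r'\<in>A. \<exists>x\<in>C t. pmap V r t x = Z r \<and> pmap V r' t x \<noteq> Z r'" if "r \<in> A" for r
    using that by simp
  then have *: "\<exists>r'. r' \<in> A \<and> \<not> k r \<subseteq> k r'" if "r \<in> A" for r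
    using that unfolding k_def by blast
  have "\<exists>r'. r' \<in> A \<and> (r' < r \<and> k r' \<noteq> k r)" if r: "r \<in> A" for r
  proof -
    obtain r' where r': "r' \<in> A" "\<not> k r \<subseteq> k r'" using *[OF r] by blast
    then have "r' < r" using kernel_mono[of t r r'] A(2)[OF r] by (force simp: k_def)
    with r' show ?thesis by auto
  qed
  with A(1) obtain f where f: "\<And>n. f n \<in> A" "\<And>n. f (Suc n) < f n \<and> k (f (Suc n)) \<noteq> k (f n)"
    using dependent_nat_choice[of "\<lambda>_ r. r \<in> A" "\<lambda>_ r r'. r' < r \<and> k r' \<noteq> k r"] by blast
  then have "\<exists>N. \<forall>n\<ge>N. k (f n) = k (f N)"
    using dcc A(2)[OF f(1)] unfolding dcc_kernels_def a_kernel_def' k_def by blast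
  then show False using f(2) by (meson le_SucI order_refl)
qed

lemma im_plus_eq_image:
  assumes "dcc_images V" "s \<in> L" "s \<le> t"
  shows "\<exists>r\<in>L. r \<le> t \<and> im_plus L t = pmap V t r ` C r"
proof -
  have "\<exists>r\<in>{r \<in> L. r \<le> t}. \<forall>r'\<in>{r \<in> L. r \<le> t}. pmap V t r ` C r \<subseteq> pmap V t r' ` C r'"
    using assms by (intro smallest_image) auto
  then obtain r where r: "r \<in> L" "r \<le> t"
    and "\<And>r'. r' \<in> L \<Longrightarrow> r' \<le> t \<Longrightarrow> pmap V t r ` C r \<subseteq> pmap V t r' ` C r'" by blast
  then have "im_plus L t = pmap V t r ` C r"
    unfolding im_plus_def by auto
  with r show ?thesis by blast
qed

text \<open>
  Both \<open>im_plus L s\<close> and \<open>im_plus L t\<close> are governed by one index \<open>r\<close>: the one whose image in \<open>V\<^sub>s\<close> is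
  \<open>im_plus L s\<close>. Without the chain condition preimages of \<open>x\<close> could exist in each image, but no
  common one.
\<close>

lemma im_plus_lift:
  assumes "dcc_images V" "s \<in> L" "s \<le> t" "x \<in> im_plus L t"
  shows "\<exists>y\<in>im_plus L s. pmap V t s y = x"
proof -
  obtain r where r: "r \<in> L" "r \<le> s" "im_plus L s = pmap V s r ` C r"
    using im_plus_eq_image[OF assms(1,2) order_refl] by blast
  then have "r \<le> t" using assms(3) by simp
  then obtain z where z: "z \<in> C r" "x = pmap V t r z"
    using assms(4) r by (auto simp: im_plus_def)
  then show ?thesis using r pmap_comp[of r s t z] assms(3) by auto
qed

text \<open>
  Membership in \<open>ker_plus U\<close> is tested at the indices of \<open>U\<close>, beyond \<open>t\<close>, so that every preimage of a
  vector of \<open>ker_plus U t\<close> already lies in \<open>ker_plus U s\<close>; only the image part has to be lifted.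
\<close>

lemma V_plus_lift:
  assumes "dcc_images V" "upper_set U" "s \<in> L" "s \<le> t" "t \<notin> U" "x \<in> V_plus L U t"
  shows "\<exists>y\<in>V_plus L U s. pmap V t s y = x"
proof -
  obtain y where y: "y \<in> im_plus L s" "pmap V t s y = x"
    using im_plus_lift assms unfolding V_plus_def by blast
  then have "y \<in> ker_plus U s"
    using ker_plus_pmap_iff[of U s t y] assms sp.submodule_subset[OF submodule_im_plus]
    unfolding V_plus_def by blast
  with y show ?thesis by (auto simp: V_plus_def)
qed

text \<open>
  Both summands of the image of \<open>x\<close> lift to \<open>V_minus L U s\<close>. What then remains of \<open>x\<close> is killed by
  the map to \<open>t\<close>, and since \<open>t\<close> lies below the cut \<open>U\<close> it belongs to \<open>ker_minus U s\<close>.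
\<close>

lemma V_minus_reflect:
  assumes "dcc_images V" "upper_set L" "upper_set U" "s \<in> L" "s \<le> t" "t \<notin> U"
    and x: "x \<in> V_plus L U s" "pmap V t s x \<in> V_minus L U t"
  shows "x \<in> V_minus L U s"
proof -
  have sU: "s \<notin> U" using assms upper_setD by blast
  obtain a b where ab: "pmap V t s x = a \<oplus>\<^bsub>pspace V t\<^esub> b"
    and a: "a \<in> im_minus L t" "a \<in> ker_plus U t" and b: "b \<in> im_plus L t" "b \<in> ker_minus U t"
    using x(2) by (auto simp: V_minus_def sp.mem_submodule_sum)
  obtain a' where a': "a' \<in> im_minus L s" "pmap V t s a' = a"
    using im_minus_lift assms a by blast
  obtain b' where b': "b' \<in> im_plus L s" "pmap V t s b' = b"
    using im_plus_lift assms b by blast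
  have C: "a' \<in> C s" "b' \<in> C s" "x \<in> C s"
    using a' b' x sp.submodule_subset[OF submodule_im_plus] sp.submodule_subset[OF submodule_im_minus]
    unfolding V_plus_def by blast+
  have a'k: "a' \<in> ker_plus U s" using ker_plus_pmap_iff[of U s t a'] assms C a a' by simp
  have b'k: "b' \<in> ker_minus U s" using ker_minus_pmap_iff[of s t U b'] assms C b b' by simp
  let ?y = "x \<ominus>\<^bsub>pspace V s\<^esub> a'"
  let ?z = "?y \<ominus>\<^bsub>pspace V s\<^esub> b'"
  have tC: "a \<in> C t" "b \<in> C t" using C a' b' assms by auto
  have "pmap V t s ?z = (a \<oplus>\<^bsub>pspace V t\<^esub> b \<ominus>\<^bsub>pspace V t\<^esub> a) \<ominus>\<^bsub>pspace V t\<^esub> b"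
    using C assms a' b' ab by (simp add: pmap_diff)
  also have "a \<oplus>\<^bsub>pspace V t\<^esub> b \<ominus>\<^bsub>pspace V t\<^esub> a = b"
    using tC by (simp add: sp.M.a_comm[where x = a and y = b] a_minus_def sp.M.a_assoc sp.M.r_neg)
  also have "b \<ominus>\<^bsub>pspace V t\<^esub> b = Z t"
    using tC by (simp add: a_minus_def sp.M.r_neg)
  finally have "pmap V t s ?z = Z t" .
  then have zk: "?z \<in> ker_minus U s"
    using C assms by (auto simp: ker_minus_def)
  have "?z \<in> im_plus L s"
    using x a' b' im_minus_subset_im_plus[OF assms(2)]
    by (intro sp.submodule_diff[OF submodule_im_plus]) (auto simp: V_plus_def)
  then have "?z \<oplus>\<^bsub>pspace V s\<^esub> b' \<in> im_plus L s \<inter> ker_minus U s"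
    using zk b' b'k sp.submodule_add[OF submodule_im_plus] sp.submodule_add[OF submodule_ker_minus[OF sU]]
    by blast
  moreover have "x = a' \<oplus>\<^bsub>pspace V s\<^esub> (?z \<oplus>\<^bsub>pspace V s\<^esub> b')"
    using C by (simp add: sp.diff_add_cancel sp.M.a_comm[where x = a' and y = ?y])
  moreover have "a' \<in> im_minus L s \<inter> ker_plus U s" using a' a'k by blast
  ultimately show ?thesis
    unfolding V_minus_def sp.mem_submodule_sum by blast
qed

end


section \<open>Intervals between two cuts\<close>

text \<open>
  The upper parts of the cuts at the lower and at the upper end of \<open>I\<close>; both are upper sets.
\<close>

definition lower_cut :: "'r::order set \<Rightarrow> 'r set" where
  "lower_cut I = {s. \<exists>i\<in>I. i \<le> s}"

definition upper_cut :: "'r::order set \<Rightarrow> 'r set" where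
  "upper_cut I = {s. \<forall>i\<in>I. i < s}"

lemma upper_set_lower_cut: "upper_set (lower_cut I)"
  by (auto simp: upper_set_def lower_cut_def intro: order_trans)

lemma upper_set_upper_cut: "upper_set (upper_cut I)"
  by (auto simp: upper_set_def upper_cut_def intro: less_le_trans)

lemma interval_eq_cuts:
  assumes "interval I"
  shows "I = lower_cut I - upper_cut I"
proof (intro equalityI subsetI)
  fix s assume "s \<in> I"
  then show "s \<in> lower_cut I - upper_cut I" by (auto simp: lower_cut_def upper_cut_def)
next
  fix s assume "s \<in> lower_cut I - upper_cut I"
  then obtain r t where "r \<in> I" "r \<le> s" "t \<in> I" "s \<le> t"
    by (auto simp: lower_cut_def upper_cut_def not_less)
  then show "s \<in> I" using assms unfolding interval_def by blast
qed

text \<open>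
  The pair of cuts is determined by the interval as soon as some \<open>t\<close> lies between them. Hence
  intervals can index the summands, although the arguments are about pairs of cuts.
\<close>

lemma interval_of_cuts:
  assumes "upper_set L" "upper_set U" "t \<in> L - (U :: 'r::linorder set)"
  shows "interval (L - U)" "lower_cut (L - U) = L" "upper_cut (L - U) = U"
proof -
  show "interval (L - U)"
    using assms unfolding interval_def upper_set_def by blast
  show "lower_cut (L - U) = L"
  proof (intro equalityI subsetI)
    fix s assume "s \<in> lower_cut (L - U)"
    then show "s \<in> L" using assms(1) by (auto simp: lower_cut_def upper_set_def)
  next
    fix s assume s: "s \<in> L"
    show "s \<in> lower_cut (L - U)"
    proof (cases "s \<in> U")
      case True
      then have "t < s" using upper_set_less[OF assms(2)] assms(3) by blast
      then show ?thesis using assms(3) by (auto simp: lower_cut_def intro: less_imp_le)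
    next
      case False
      then show ?thesis using s by (auto simp: lower_cut_def)
    qed
  qed
  show "upper_cut (L - U) = U"
  proof (intro equalityI subsetI)
    fix s assume s: "s \<in> upper_cut (L - U)"
    then have "t < s" using assms(3) by (auto simp: upper_cut_def)
    then have "s \<in> L" using assms upper_setD[of L t s] by auto
    then show "s \<in> U" using s by (auto simp: upper_cut_def)
  next
    fix s assume "s \<in> U"
    then show "s \<in> upper_cut (L - U)"
      using upper_set_less[OF assms(2)] by (auto simp: upper_cut_def)
  qed
qed

text \<open>
  If \<open>I\<close> has no least element, then below any \<open>s \<in> I\<close> there is a non-empty open interval inside \<open>I\<close>,
  which meets the dense set. So \<open>D \<inter> I\<close> gets below every element of \<open>I\<close>, and running minima of
  an enumeration of it form the sequence.
\<close>

lemma coinitial_sequence: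
  fixes I D :: "'r::linorder_topology set"
  assumes D: "countable D" "closure D = UNIV" and I: "interval I"
  obtains a :: "nat \<Rightarrow> 'r" where "\<And>n. a n \<in> I" "\<And>n. a (Suc n) \<le> a n"
    "\<And>s. s \<in> I \<Longrightarrow> \<exists>n. a n \<le> s"
proof -
  obtain t0 where t0: "t0 \<in> I" using I by (auto simp: interval_def)
  obtain E where E: "countable E" "E \<subseteq> I" and coinit: "\<And>s. s \<in> I \<Longrightarrow> \<exists>d\<in>E. d \<le> s"
  proof (cases "\<exists>m\<in>I. \<forall>s\<in>I. m \<le> s")
    case True
    then obtain m where "m \<in> I" "\<And>s. s \<in> I \<Longrightarrow> m \<le> s" by blast
    then show thesis by (intro that[of "{m}"]) auto
  next
    case False
    have "\<exists>d\<in>D \<inter> I. d \<le> s" if s: "s \<in> I" for s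
    proof -
      obtain s' where s': "s' \<in> I" "s' < s" using False s by (meson not_le)
      obtain s'' where s'': "s'' \<in> I" "s'' < s'" using False s' by (meson not_le)
      have "s' \<in> {s''<..<s}" using s' s'' by simp
      then have "{s''<..<s} \<inter> D \<noteq> {}"
        using open_Int_closure_eq_empty[of "{s''<..<s}" D] D(2) by auto
      then obtain d where d: "d \<in> D" "s'' < d" "d < s" by auto
      then have "d \<in> I" using I s s'' unfolding interval_def by (meson less_imp_le)
      with d show ?thesis by (auto intro: less_imp_le)
    qed
    then show thesis using D(1) by (intro that[of "D \<inter> I"]) auto
  qed
  have ne: "E \<noteq> {}" using coinit t0 by blast
  \<comment> \<open>the minimum makes the sequence decreasing while it passes below each enumerated element\<close>
  define a where "a = rec_nat t0 (\<lambda>n x. min x (from_nat_into E n))"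
  have a_Suc: "a (Suc n) = min (a n) (from_nat_into E n)" for n by (simp add: a_def)
  have a0: "a 0 = t0" by (simp add: a_def)
  show thesis
  proof (rule that)
    show "a n \<in> I" for n
      by (induction n) (use a0 a_Suc t0 from_nat_into[OF ne] E(2) in \<open>auto simp: min_def\<close>)
    show "a (Suc n) \<le> a n" for n by (simp add: a_Suc)
    show "\<exists>n. a n \<le> s" if s: "s \<in> I" for s
    proof -
      obtain d where d: "d \<in> E" "d \<le> s" using coinit[OF s] by blast
      obtain n where "from_nat_into E n = d" using from_nat_into_surj[OF E(1) d(1)] by blast
      then have "a (Suc n) \<le> s" using d(2) by (auto simp: a_Suc min_def)
      then show ?thesis by blast
    qed
  qed
qed

section \<open>Threads through an interval\<close>

context persistence_module
begin

text \<open>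
  Preimages \<open>x n\<close> are chosen one step at a time down the sequence \<open>a\<close>. Every other index \<open>t\<close> lies
  above some \<open>a n\<close> and receives the image of \<open>x n\<close>, which is independent of \<open>n\<close> by compatibility.
\<close>

lemma thread_through:
  assumes dcc: "dcc_images V" and L: "upper_set L" and U: "upper_set U"
    and aI: "\<And>n. a n \<in> L - U" and dec: "\<And>n::nat. a (Suc n) \<le> a n"
    and coinit: "\<And>s. s \<in> L - U \<Longrightarrow> \<exists>n. a n \<le> s"
    and b: "b \<in> V_plus L U (a 0)"
  shows "\<exists>e. e (a 0) = b \<and> (\<forall>t\<in>L - U. e t \<in> V_plus L U t) \<and>
           (\<forall>s\<in>L - U. \<forall>t\<in>L - U. s \<le> t \<longrightarrow> pmap V t s (e s) = e t)"
proof -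
  let ?P = "\<lambda>n y. y \<in> V_plus L U (a n) \<and> (n = 0 \<longrightarrow> y = b)"
  have "\<exists>x. \<forall>n. ?P n (x n) \<and> pmap V (a n) (a (Suc n)) (x (Suc n)) = x n"
  proof (rule dependent_nat_choice)
    show "\<exists>y. ?P 0 y" using b by blast
    fix y n assume "?P n y"
    then show "\<exists>y'. ?P (Suc n) y' \<and> pmap V (a n) (a (Suc n)) y' = y"
      using V_plus_lift[OF dcc U _ dec, of n L y] aI by blast
  qed
  then obtain x where x: "\<And>n. x n \<in> V_plus L U (a n)" "x 0 = b"
    "\<And>n. pmap V (a n) (a (Suc n)) (x (Suc n)) = x n" by blast
  have xC: "x n \<in> C (a n)" for n by (rule sp.submodule_subset[OF submodule_V_plus x(1)])
  have anti: "a m \<le> a n" if "n \<le> m" for m n by (rule lift_Suc_antimono_le[of a, OF dec that])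
  have down: "pmap V (a n) (a m) (x m) = x n" if "n \<le> m" for m n
    using that
  proof (induction m rule: dec_induct)
    case base
    then show ?case using pmap_refl[OF xC] by simp
  next
    case (step m)
    then show ?case
      using pmap_comp[OF dec[of m] anti[of n m] xC[of "Suc m"]] x(3)[of m] by simp
  qed
  define N where "N t = (LEAST n. a n \<le> t)" for t
  define e where "e t = pmap V t (a (N t)) (x (N t))" for t
  have e_eq: "e t = pmap V t (a n) (x n)" if n: "a n \<le> t" for t n
  proof -
    have "N t \<le> n" "a (N t) \<le> t"
      unfolding N_def using n by (auto intro: Least_le LeastI)
    then show ?thesis
      using pmap_comp[OF anti[of "N t" n] _ xC[of n], of t] down[of "N t" n] by (simp add: e_def)
  qed
  have "e (a 0) = b" using e_eq[of 0 "a 0"] pmap_refl[OF xC[of 0]] x(2) by simp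
  moreover have "e t \<in> V_plus L U t" if t: "t \<in> L - U" for t
  proof -
    obtain n where n: "a n \<le> t" using coinit[OF t] by blast
    then show ?thesis using V_plus_push[OF U n _ x(1)] t e_eq[OF n] by simp
  qed
  moreover have "pmap V t s (e s) = e t" if s: "s \<in> L - U" and st: "s \<le> t" for s t
  proof -
    obtain n where n: "a n \<le> s" using coinit[OF s] by blast
    then have "a n \<le> t" using st by simp
    then show ?thesis using e_eq n pmap_comp[OF n st xC] by simp
  qed
  ultimately show ?thesis by blast
qed

text \<open>
  Two indices \<open>s \<le> t\<close> of the interval \<open>L - U\<close>, and a family at \<open>s\<close> together with its image at \<open>t\<close>.
  Since the map from \<open>s\<close> to \<open>t\<close> induces an isomorphism of \<open>V_plus\<close> modulo \<open>V_minus\<close>, either family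
  is a basis of this quotient if and only if the other one is.
\<close>

context
  fixes L U s t and f g :: "'j \<Rightarrow> 'v" and B
  assumes dcc: "dcc_images V" and L: "upper_set L" and U: "upper_set U"
    and s: "s \<in> L - U" and t: "t \<in> L - U" and st: "s \<le> t"
    and f: "\<And>b. b \<in> B \<Longrightarrow> f b \<in> V_plus L U s"
    and g: "\<And>b. b \<in> B \<Longrightarrow> pmap V t s (f b) = g b"
begin

lemma V_minus_pmap_iff: "x \<in> V_plus L U s \<Longrightarrow> pmap V t s x \<in> V_minus L U t \<longleftrightarrow> x \<in> V_minus L U s"
  using V_minus_push[OF U st] V_minus_reflect[OF dcc L U _ st] s t by blast

lemma indep_mod_transfer:
  "indep_mod K (pspace V s) (V_minus L U s) f B \<longleftrightarrow> indep_mod K (pspace V t) (V_minus L U t) g B"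
proof -
  have fC: "f b \<in> C s" if "b \<in> B" for b using f[OF that] sp.submodule_subset[OF submodule_V_plus] by blast
  have gC: "g b \<in> C t" if "b \<in> B" for b using pmap_closed[OF st fC[OF that]] g[OF that] by simp
  have "(\<Oplus>\<^bsub>pspace V s\<^esub>j\<in>F. c j \<odot>\<^bsub>pspace V s\<^esub> f j) \<in> V_minus L U s \<longleftrightarrow>
        (\<Oplus>\<^bsub>pspace V t\<^esub>j\<in>F. c j \<odot>\<^bsub>pspace V t\<^esub> g j) \<in> V_minus L U t"
    if F: "finite F" "F \<subseteq> B" "c \<in> F \<rightarrow> carrier K" for F c
  proof -
    have c: "c j \<in> carrier K" if "j \<in> F" for j using F(3) that by blast
    have "pmap V t s (\<Oplus>\<^bsub>pspace V s\<^esub>j\<in>F. c j \<odot>\<^bsub>pspace V s\<^esub> f j)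
        = (\<Oplus>\<^bsub>pspace V t\<^esub>j\<in>F. c j \<odot>\<^bsub>pspace V t\<^esub> pmap V t s (f j))"
      using F(2) fC c by (intro pmap_comb[OF st F(1)]) auto
    also have "\<dots> = (\<Oplus>\<^bsub>pspace V t\<^esub>j\<in>F. c j \<odot>\<^bsub>pspace V t\<^esub> g j)"
      using F(2) gC g c by (intro sp.M.finsum_cong') auto
    finally have *: "pmap V t s (\<Oplus>\<^bsub>pspace V s\<^esub>j\<in>F. c j \<odot>\<^bsub>pspace V s\<^esub> f j)
        = (\<Oplus>\<^bsub>pspace V t\<^esub>j\<in>F. c j \<odot>\<^bsub>pspace V t\<^esub> g j)" .
    have "(\<Oplus>\<^bsub>pspace V s\<^esub>j\<in>F. c j \<odot>\<^bsub>pspace V s\<^esub> f j) \<in> V_plus L U s"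
      using F(2) c f
      by (intro sp.submodule_finsum[OF submodule_V_plus F(1)] sp.submodule_smult[OF submodule_V_plus]) auto
    from V_minus_pmap_iff[OF this] show ?thesis unfolding * by simp
  qed
  then show ?thesis unfolding indep_mod_def by (metis (no_types, lifting))
qed

lemma spans_mod_transfer:
  "spans_mod K (pspace V s) (V_minus L U s) f B (V_plus L U s) \<longleftrightarrow>
   spans_mod K (pspace V t) (V_minus L U t) g B (V_plus L U t)" (is "?S \<longleftrightarrow> ?T")
proof
  assume S: ?S
  show ?T unfolding spans_mod_def
  proof (intro allI impI, elim conjE)
    fix X assume X: "submodule K X (pspace V t)" "V_minus L U t \<subseteq> X" "g ` B \<subseteq> X"
    let ?Y = "{x \<in> C s. pmap V t s x \<in> X}"
    have "submodule K ?Y (pspace V s)"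
      using sp.submodule_add[OF X(1)] sp.submodule_smult[OF X(1)] sp.submodule_zero_mem[OF X(1)] st
      unfolding submodule_def by (auto simp: sp.module_axioms pmap_add pmap_smult)
    moreover have "V_minus L U s \<subseteq> ?Y"
      using V_minus_push[OF U st] t X(2) sp.submodule_subset[OF submodule_V_minus] s by blast
    moreover have "f ` B \<subseteq> ?Y"
      using f g X(3) sp.submodule_subset[OF submodule_V_plus] by blast
    ultimately have "V_plus L U s \<subseteq> ?Y" using S unfolding spans_mod_def by blast
    then show "V_plus L U t \<subseteq> X" using V_plus_lift[OF dcc U _ st] s t by blast
  qed
next
  assume T: ?T
  show ?S unfolding spans_mod_def
  proof (intro allI impI, elim conjE)
    fix X assume X: "submodule K X (pspace V s)" "V_minus L U s \<subseteq> X" "f ` B \<subseteq> X"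
    \<comment> \<open>intersecting with \<open>V_plus\<close> makes the preimages found in \<open>X\<close> comparable with \<open>x\<close>, as
      \<open>V_minus_pmap_iff\<close> requires vectors of \<open>V_plus\<close>\<close>
    let ?X = "X \<inter> V_plus L U s"
    let ?Y = "sp.submodule_sum t (V_minus L U t) (pmap V t s ` ?X)"
    have subX: "submodule K ?X (pspace V s)" by (intro sp.submodule_Int X(1) submodule_V_plus)
    have subI: "submodule K (pmap V t s ` ?X) (pspace V t)"
      unfolding submodule_def
    proof (intro conjI allI impI)
      show "module K (pspace V t)" by (rule sp.module_axioms)
      show "pmap V t s ` ?X \<subseteq> C t" using st sp.submodule_subset[OF subX] by auto
      show "Z t \<in> pmap V t s ` ?X"
        using sp.submodule_zero_mem[OF subX] pmap_zero[OF st] by (metis imageI)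
      fix v w assume "v \<in> pmap V t s ` ?X" "w \<in> pmap V t s ` ?X"
      then obtain v' w' where "v' \<in> ?X" "w' \<in> ?X" "v = pmap V t s v'" "w = pmap V t s w'" by blast
      then show "v \<oplus>\<^bsub>pspace V t\<^esub> w \<in> pmap V t s ` ?X"
        using pmap_add[OF st] sp.submodule_subset[OF subX] sp.submodule_add[OF subX] by (metis imageI)
    next
      fix c v assume "c \<in> carrier K" "v \<in> pmap V t s ` ?X"
      moreover then obtain v' where "v' \<in> ?X" "v = pmap V t s v'" by blast
      ultimately show "c \<odot>\<^bsub>pspace V t\<^esub> v \<in> pmap V t s ` ?X"
        using pmap_smult[OF st] sp.submodule_subset[OF subX] sp.submodule_smult[OF subX] by (metis imageI)
    qed
    have subN: "submodule K (V_minus L U t) (pspace V t)" using t by (intro submodule_V_minus) simp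
    have "submodule K ?Y (pspace V t)" by (rule sp.sum_is_submodule[OF subN subI])
    moreover have "V_minus L U t \<subseteq> ?Y" by (rule sp.in_sum[OF subN subI])
    moreover have "pmap V t s ` ?X \<subseteq> ?Y"
      using sp.in_sum[OF subI subN] sp.msum_comm[OF subN subI] by simp
    then have "g ` B \<subseteq> ?Y" using f g X(3) by (force simp: image_iff)
    ultimately have Y: "V_plus L U t \<subseteq> ?Y" using T unfolding spans_mod_def by blast
    show "V_plus L U s \<subseteq> X"
    proof
      fix x assume x: "x \<in> V_plus L U s"
      then have "pmap V t s x \<in> ?Y" using Y V_plus_push[OF U st _ x] t by blast
      then obtain n y where n: "n \<in> V_minus L U t" and y: "y \<in> ?X"
        and xe: "pmap V t s x = n \<oplus>\<^bsub>pspace V t\<^esub> pmap V t s y"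
        by (auto simp: sp.mem_submodule_sum)
      have C: "x \<in> C s" "y \<in> C s" "n \<in> C t"
        using x y n sp.submodule_subset[OF submodule_V_plus] sp.submodule_subset[OF subN] by blast+
      have "pmap V t s (x \<ominus>\<^bsub>pspace V s\<^esub> y) = n"
        using C st unfolding pmap_diff[OF st C(1,2)] xe
        by (simp add: a_minus_def sp.M.a_assoc sp.M.r_neg)
      moreover have "x \<ominus>\<^bsub>pspace V s\<^esub> y \<in> V_plus L U s"
        using x y by (intro sp.submodule_diff[OF submodule_V_plus]) auto
      ultimately have "x \<ominus>\<^bsub>pspace V s\<^esub> y \<in> V_minus L U s" using V_minus_pmap_iff n by blast
      then have "(x \<ominus>\<^bsub>pspace V s\<^esub> y) \<oplus>\<^bsub>pspace V s\<^esub> y \<in> X"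
        using X(2) y by (intro sp.submodule_add[OF X(1)]) auto
      then show "x \<in> X" using C by (simp add: sp.diff_add_cancel)
    qed
  qed
qed

end

text \<open>
  One index set \<open>B\<close> gives compatible bases of \<open>V_plus\<close> modulo \<open>V_minus\<close> at all indices of the
  interval. \<open>B\<close> consists of vectors only because it is chosen inside the space at one of these indices.
\<close>

definition thread_basis :: "'r set \<Rightarrow> 'r set \<Rightarrow> 'v set \<Rightarrow> ('v \<Rightarrow> 'r \<Rightarrow> 'v) \<Rightarrow> bool" where
  "thread_basis L U B e \<longleftrightarrow>
     (\<forall>b\<in>B. \<forall>t\<in>L - U. e b t \<in> V_plus L U t) \<and>
     (\<forall>b\<in>B. \<forall>s\<in>L - U. \<forall>t\<in>L - U. s \<le> t \<longrightarrow> pmap V t s (e b s) = e b t) \<and>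
     (\<forall>t\<in>L - U. indep_mod K (pspace V t) (V_minus L U t) (\<lambda>b. e b t) B \<and>
        spans_mod K (pspace V t) (V_minus L U t) (\<lambda>b. e b t) B (V_plus L U t))"

lemma exists_thread_basis:
  assumes dcc: "dcc_images V" and L: "upper_set L" and U: "upper_set U"
    and aI: "\<And>n. a n \<in> L - U" and dec: "\<And>n::nat. a (Suc n) \<le> a n"
    and coinit: "\<And>s. s \<in> L - U \<Longrightarrow> \<exists>n. a n \<le> s"
  shows "\<exists>B e. thread_basis L U B e"
proof -
  let ?t = "a 0"
  have "\<exists>B\<subseteq>V_plus L U ?t. indep_mod K (pspace V ?t) (V_minus L U ?t) (\<lambda>b. b) B \<and>
      spans_mod K (pspace V ?t) (V_minus L U ?t) (\<lambda>b. b) B (V_plus L U ?t)"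
    using sp.submodule_subset[OF submodule_V_plus] by (intro sp.exists_basis_mod) blast
  then obtain B where B: "B \<subseteq> V_plus L U ?t"
    and ind: "indep_mod K (pspace V ?t) (V_minus L U ?t) (\<lambda>b. b) B"
    and span: "spans_mod K (pspace V ?t) (V_minus L U ?t) (\<lambda>b. b) B (V_plus L U ?t)"
    by blast
  have "\<exists>e. \<forall>b\<in>B. e b ?t = b \<and> (\<forall>t\<in>L - U. e b t \<in> V_plus L U t) \<and>
      (\<forall>s\<in>L - U. \<forall>t\<in>L - U. s \<le> t \<longrightarrow> pmap V t s (e b s) = e b t)"
    using B thread_through[OF dcc L U aI dec coinit] by (intro bchoice ballI) blast
  then obtain e where e: "\<forall>b\<in>B. e b ?t = b \<and> (\<forall>t\<in>L - U. e b t \<in> V_plus L U t) \<and>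
      (\<forall>s\<in>L - U. \<forall>t\<in>L - U. s \<le> t \<longrightarrow> pmap V t s (e b s) = e b t)"
    by (elim exE)
  have e0: "e b ?t = b" if "b \<in> B" for b using e that by simp
  have eV: "e b t \<in> V_plus L U t" if "b \<in> B" "t \<in> L - U" for b t using e that by simp
  have comp: "pmap V t s (e b s) = e b t"
    if "b \<in> B" "s \<in> L - U" "t \<in> L - U" "s \<le> t" for b s t using e that by simp
  have ind': "indep_mod K (pspace V ?t) (V_minus L U ?t) (\<lambda>b. e b ?t) B"
    using ind e0 B sp.submodule_subset[OF submodule_V_plus]
    by (subst sp.indep_mod_cong[of B "\<lambda>b. e b ?t" "\<lambda>b. b"]) auto
  have span': "spans_mod K (pspace V ?t) (V_minus L U ?t) (\<lambda>b. e b ?t) B (V_plus L U ?t)"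
    using span e0
    by (subst spans_mod_cong[of B "\<lambda>b. e b ?t" "\<lambda>b. b"]) auto
  have "indep_mod K (pspace V t) (V_minus L U t) (\<lambda>b. e b t) B \<and>
      spans_mod K (pspace V t) (V_minus L U t) (\<lambda>b. e b t) B (V_plus L U t)" if t: "t \<in> L - U" for t
  proof (cases "?t \<le> t")
    case True
    show ?thesis
      using indep_mod_transfer[OF dcc L U aI t True, of B "\<lambda>b. e b ?t" "\<lambda>b. e b t"]
        spans_mod_transfer[OF dcc L U aI t True, of B "\<lambda>b. e b ?t" "\<lambda>b. e b t"]
        eV[OF _ aI] comp[OF _ aI t True] ind' span' by blast
  next
    case False
    then have le: "t \<le> ?t" by simp
    show ?thesis
      using indep_mod_transfer[OF dcc L U t aI le, of B "\<lambda>b. e b t" "\<lambda>b. e b ?t"]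
        spans_mod_transfer[OF dcc L U t aI le, of B "\<lambda>b. e b t" "\<lambda>b. e b ?t"]
        eV[OF _ t] comp[OF _ t aI le] ind' span' by blast
  qed
  with eV comp show ?thesis
    by (intro exI[of _ B] exI[of _ e]) (simp add: thread_basis_def)
qed

end

section \<open>Threads of all intervals form a basis of each space\<close>

context persistence_module
begin

text \<open>
  Different cuts give nested pairs of subspaces: the larger space for one cut is contained in the
  smaller space for the other. Independence rests on this.
\<close>

lemma im_plus_subset_im_minus: "r \<in> L' \<Longrightarrow> r \<notin> L \<Longrightarrow> r \<le> t \<Longrightarrow> im_plus L' t \<subseteq> im_minus L t"
  by (auto simp: im_plus_def im_minus_def)

lemma ker_plus_subset_ker_minus: "r \<in> U' \<Longrightarrow> r \<notin> U \<Longrightarrow> t \<le> r \<Longrightarrow> ker_plus U' t \<subseteq> ker_minus U t"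
  by (auto simp: ker_plus_def ker_minus_def)

text \<open>
  The hypothesis \<open>step\<close> holds for every subspace \<open>X\<close> that contains all threads at \<open>t\<close>. In a
  counterexample the cuts \<open>L\<close> and \<open>U\<close> are the thresholds at which \<open>X\<close> ceases to contain the images,
  and then the kernels within \<open>im_plus L t\<close>. The chain conditions
  ensure that \<open>im_plus L t\<close> and its intersection with \<open>ker_plus U t\<close> still fail to be contained in \<open>X\<close>,
  although they are intersections.
\<close>

lemma spans_from_intervals:
  assumes dccI: "dcc_images V" and dccK: "dcc_kernels V"
    and X: "submodule K X (pspace V t)"
    and step: "\<And>I. interval I \<Longrightarrow> t \<in> I \<Longrightarrow> V_minus (lower_cut I) (upper_cut I) t \<subseteq> X
                 \<Longrightarrow> V_plus (lower_cut I) (upper_cut I) t \<subseteq> X"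
  shows "C t \<subseteq> X"
proof (rule ccontr)
  assume nX: "\<not> C t \<subseteq> X"
  define L where "L = {s. s \<le> t \<longrightarrow> \<not> pmap V t s ` C s \<subseteq> X}"
  have "pmap V t t ` C t = C t" using pmap_refl by force
  then have tL: "t \<in> L" using nX by (simp add: L_def)
  have L: "upper_set L"
    unfolding upper_set_def
  proof (intro ballI allI impI)
    fix s s' assume s: "s \<in> L" "s \<le> s'"
    have "\<not> pmap V t s' ` C s' \<subseteq> X" if "s' \<le> t"
      using s image_mono[OF s(2) that] order_trans[OF s(2) that] by (auto simp: L_def)
    then show "s' \<in> L" by (simp add: L_def)
  qed
  obtain r where "r \<in> L" "r \<le> t" "im_plus L t = pmap V t r ` C r"
    using im_plus_eq_image[OF dccI tL order_refl] by blast
  then have imp: "\<not> im_plus L t \<subseteq> X" by (auto simp: L_def)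
  have imm: "im_minus L t \<subseteq> X"
    using sp.submodule_zero_mem[OF X] by (auto simp: im_minus_def L_def)
  define ker where "ker r = {x \<in> C t. pmap V r t x = Z r}" for r
  define U where "U = {r. t \<le> r \<and> \<not> im_plus L t \<inter> ker r \<subseteq> X}"
  have ker_mono: "ker r \<subseteq> ker r'" if "t \<le> r" "r \<le> r'" for r r'
    using kernel_mono[OF that] by (auto simp: ker_def)
  have U: "upper_set U"
    unfolding upper_set_def
  proof (intro ballI allI impI)
    fix r r' assume r: "r \<in> U" "r \<le> r'"
    then have "t \<le> r" "\<not> im_plus L t \<inter> ker r \<subseteq> X" by (auto simp: U_def)
    then show "r' \<in> U" using ker_mono[OF _ r(2)] r(2) by (auto simp: U_def)
  qed
  have "ker t \<subseteq> X" using pmap_refl sp.submodule_zero_mem[OF X] by (auto simp: ker_def)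
  then have tU: "t \<notin> U" by (auto simp: U_def)
  have kerm: "im_plus L t \<inter> ker_minus U t \<subseteq> X"
  proof
    fix x assume "x \<in> im_plus L t \<inter> ker_minus U t"
    then obtain r where "r \<notin> U" "t \<le> r" "x \<in> im_plus L t \<inter> ker r"
      by (auto simp: ker_minus_def ker_def)
    then show "x \<in> X" by (auto simp: U_def)
  qed
  have kerp: "\<not> im_plus L t \<inter> ker_plus U t \<subseteq> X"
  proof (cases "U = {}")
    case True
    then show ?thesis using imp by (auto simp: ker_plus_def im_plus_def)
  next
    case False
    then have "\<exists>r\<in>U. \<forall>r'\<in>U. \<forall>x\<in>C t. pmap V r t x = Z r \<longrightarrow> pmap V r' t x = Z r'"
      by (intro smallest_kernel[OF dccK]) (auto simp: U_def)
    then obtain r where r: "r \<in> U" "\<And>r' x. r' \<in> U \<Longrightarrow> x \<in> C t \<Longrightarrow> pmap V r t x = Z r \<Longrightarrow> pmap V r' t x = Z r'"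
      by blast
    then have "ker r \<subseteq> ker_plus U t" by (auto simp: ker_def ker_plus_def)
    then show ?thesis using r(1) by (auto simp: U_def)
  qed
  have tI: "t \<in> L - U" using tL tU by simp
  have "V_minus L U t \<subseteq> X"
    using imm kerm sp.submodule_add[OF X] by (fastforce simp: V_minus_def sp.mem_submodule_sum)
  then have "V_plus L U t \<subseteq> X"
    using step[of "L - U"] interval_of_cuts[OF L U tI] tI by simp
  then show False using kerp by (simp add: V_plus_def)
qed

text \<open>
  Among the intervals with a nonzero coefficient in a relation take \<open>I\<close> with \<open>lower_cut I\<close> minimal,
  and then with \<open>upper_cut I\<close> minimal. Small upper sets belong to late cuts and thus to large images
  and kernels, so the terms of all other intervals fall into the subspace \<open>Q\<close>, and \<open>Q\<close> meets
  \<open>V_plus\<close> of \<open>I\<close> in \<open>V_minus\<close>.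
\<close>

lemma indep_from_intervals:
  assumes int: "\<And>I. I \<in> A \<Longrightarrow> interval I" and tI: "\<And>I. I \<in> A \<Longrightarrow> t \<in> I"
    and E: "\<And>I b. I \<in> A \<Longrightarrow> b \<in> B I \<Longrightarrow> E (I, b) \<in> V_plus (lower_cut I) (upper_cut I) t"
    and ind: "\<And>I. I \<in> A \<Longrightarrow>
      indep_mod K (pspace V t) (V_minus (lower_cut I) (upper_cut I) t) (\<lambda>b. E (I, b)) (B I)"
  shows "indep_mod K (pspace V t) {Z t} E (Sigma A B)"
  unfolding indep_mod_def
proof (intro allI impI, elim conjE, rule ccontr)
  fix F c assume F: "finite F" "F \<subseteq> Sigma A B" "c \<in> F \<rightarrow> carrier K"
    and sum0: "(\<Oplus>\<^bsub>pspace V t\<^esub>j\<in>F. c j \<odot>\<^bsub>pspace V t\<^esub> E j) \<in> {Z t}"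
    and nz: "\<not> (\<forall>j\<in>F. c j = \<zero>\<^bsub>K\<^esub>)"
  define T where "T j = c j \<odot>\<^bsub>pspace V t\<^esub> E j" for j
  define G where "G = {j \<in> F. c j \<noteq> \<zero>\<^bsub>K\<^esub>}"
  have G: "finite G" "G \<noteq> {}" "G \<subseteq> F" using F nz by (auto simp: G_def)
  have EV: "E j \<in> V_plus (lower_cut (fst j)) (upper_cut (fst j)) t" if "j \<in> F" for j
    using F(2) that E by (cases j) auto
  have TV: "T j \<in> V_plus (lower_cut (fst j)) (upper_cut (fst j)) t" if "j \<in> F" for j
    unfolding T_def using F(3) that EV[OF that] by (intro sp.submodule_smult[OF submodule_V_plus]) auto
  then have TC: "T j \<in> C t" if "j \<in> F" for j using that sp.submodule_subset[OF submodule_V_plus] by blast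
  have EC: "E j \<in> C t" if "j \<in> F" for j using EV[OF that] sp.submodule_subset[OF submodule_V_plus] by blast
  have "finsum (pspace V t) T {j \<in> F. \<not> c j \<noteq> \<zero>\<^bsub>K\<^esub>} = Z t"
    using EC by (intro sp.M.add.finprod_one_eqI) (auto simp: T_def)
  moreover have "finsum (pspace V t) T G \<in> C t" using TC G(3) by (intro sp.M.finsum_closed) blast
  ultimately have sumG: "finsum (pspace V t) T G = Z t"
    using sp.finsum_split[OF F(1) TC, where P = "\<lambda>j. c j \<noteq> \<zero>\<^bsub>K\<^esub>"] sum0
    unfolding G_def[symmetric] T_def[symmetric] by simp
  obtain L where L: "L \<in> lower_cut ` fst ` G" "\<forall>L'\<in>lower_cut ` fst ` G. L' \<subseteq> L \<longrightarrow> L = L'"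
    by (rule bexE[OF finite_has_minimal[of "lower_cut ` fst ` G"]]) (use G in auto)
  let ?U = "upper_cut ` {I \<in> fst ` G. lower_cut I = L}"
  have U0: "finite ?U" "?U \<noteq> {}" using L(1) G by auto
  obtain U where U: "U \<in> ?U" "\<forall>U'\<in>?U. U' \<subseteq> U \<longrightarrow> U = U'"
    by (rule bexE[OF finite_has_minimal[OF U0]])
  have Lmin: "lower_cut (fst j) \<subseteq> L \<Longrightarrow> lower_cut (fst j) = L" if "j \<in> G" for j
    using L(2) that by auto
  have Umin: "upper_cut (fst j) \<subseteq> U \<Longrightarrow> upper_cut (fst j) = U" if "j \<in> G" "lower_cut (fst j) = L" for j
    using U(2) that by auto
  obtain I where I: "I \<in> fst ` G" "lower_cut I = L" "upper_cut I = U" using U(1) by auto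
  have IA: "I \<in> A" using I(1) G F by auto
  have uL: "upper_set L" and uU: "upper_set U"
    using I upper_set_lower_cut[of I] upper_set_upper_cut[of I] by auto
  have mem: "t \<in> lower_cut I'" "t \<notin> upper_cut I'" if "I' \<in> A" for I'
    using interval_eq_cuts[OF int[OF that]] tI[OF that] by blast+
  have tLU: "t \<in> L" "t \<notin> U" using mem[OF IA] I by auto
  define Q where "Q = sp.submodule_sum t (im_minus L t) (im_plus L t \<inter> ker_minus U t)"
  have s1: "submodule K (im_minus L t) (pspace V t)" by (rule submodule_im_minus)
  have s2: "submodule K (im_plus L t \<inter> ker_minus U t) (pspace V t)"
    using tLU by (intro sp.submodule_Int submodule_im_plus submodule_ker_minus)
  have subQ: "submodule K Q (pspace V t)" unfolding Q_def by (rule sp.sum_is_submodule[OF s1 s2])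
  have inQ: "im_minus L t \<subseteq> Q" "im_plus L t \<inter> ker_minus U t \<subseteq> Q"
    unfolding Q_def using sp.in_sum[OF s1 s2] sp.in_sum[OF s2 s1] sp.msum_comm[OF s1 s2] by auto
  have other: "T j \<in> Q" if j: "j \<in> G" "fst j \<noteq> I" for j
  proof -
    let ?I = "fst j"
    have jA: "?I \<in> A" using j G F by auto
    have Tj: "T j \<in> im_plus (lower_cut ?I) t" "T j \<in> ker_plus (upper_cut ?I) t"
      using TV[of j] j G by (auto simp: V_plus_def)
    show ?thesis
    proof (cases "lower_cut ?I = L")
      case False
      then have "\<not> lower_cut ?I \<subseteq> L" using Lmin[OF j(1)] by blast
      then obtain r where r: "r \<in> lower_cut ?I" "r \<notin> L" by blast
      then have "r \<le> t" using upper_set_less[OF uL tLU(1)] by force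
      then show ?thesis using im_plus_subset_im_minus[OF r] Tj inQ by blast
    next
      case True
      have "upper_cut ?I \<noteq> U"
        using True I j(2) interval_eq_cuts[OF int[OF jA]] interval_eq_cuts[OF int[OF IA]] by metis
      then have "\<not> upper_cut ?I \<subseteq> U" using Umin[OF j(1) True] by blast
      then obtain r where r: "r \<in> upper_cut ?I" "r \<notin> U" by blast
      then have "t \<le> r" using upper_set_less[OF upper_set_upper_cut _ mem(2)[OF jA]] by force
      then show ?thesis using ker_plus_subset_ker_minus[OF r] Tj True inQ by blast
    qed
  qed
  let ?S = "finsum (pspace V t) T {j \<in> G. fst j = I}"
  let ?R = "finsum (pspace V t) T {j \<in> G. \<not> fst j = I}"
  have R: "?R \<in> Q" using G other by (intro sp.submodule_finsum[OF subQ]) auto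
  have S: "?S \<in> V_plus L U t"
    using G TV I by (intro sp.submodule_finsum[OF submodule_V_plus]) auto
  have C: "?S \<in> C t" "?R \<in> C t"
    using sp.submodule_subset[OF submodule_V_plus S] sp.submodule_subset[OF subQ R] by auto
  have "?S \<oplus>\<^bsub>pspace V t\<^esub> ?R = Z t"
    using sp.finsum_split[of G T t "\<lambda>j. fst j = I"] sumG G TC by (auto simp: subset_iff)
  then have "?S = \<ominus>\<^bsub>pspace V t\<^esub> ?R" using C by (simp add: sp.M.minus_equality)
  then have "?S \<in> Q" using sp.submodule_neg[OF subQ R] by simp
  then obtain x y where x: "x \<in> im_minus L t" and y: "y \<in> im_plus L t" "y \<in> ker_minus U t"
    and xy: "?S = x \<oplus>\<^bsub>pspace V t\<^esub> y"
    by (auto simp: Q_def sp.mem_submodule_sum)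
  have xyC: "x \<in> C t" "y \<in> C t"
    using sp.submodule_subset[OF s1 x] y by (auto simp: im_plus_def)
  \<comment> \<open>the component \<open>x\<close> is a difference of vectors of \<open>ker_plus U t\<close>, so the decomposition of the
    sum in \<open>Q\<close> is one in \<open>V_minus L U t\<close>\<close>
  have "?S \<ominus>\<^bsub>pspace V t\<^esub> y \<in> ker_plus U t"
    using S y ker_minus_subset_ker_plus[OF uU]
    by (intro sp.submodule_diff[OF submodule_ker_plus]) (auto simp: V_plus_def)
  moreover have "?S \<ominus>\<^bsub>pspace V t\<^esub> y = x"
    unfolding xy using xyC by (simp add: a_minus_def sp.M.a_assoc sp.M.r_neg)
  ultimately have "?S \<in> V_minus L U t"
    using x y xy unfolding V_minus_def sp.mem_submodule_sum by blast
  moreover have "?S = (\<Oplus>\<^bsub>pspace V t\<^esub>b\<in>{b. (I, b) \<in> G}. c (I, b) \<odot>\<^bsub>pspace V t\<^esub> E (I, b))"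
  proof -
    have "{j \<in> G. fst j = I} = Pair I ` {b. (I, b) \<in> G}" by force
    moreover have "T \<in> Pair I ` {b. (I, b) \<in> G} \<rightarrow> C t" using TC G(3) by blast
    ultimately show ?thesis
      using sp.M.finsum_reindex[of T "Pair I" "{b. (I, b) \<in> G}" t]
      by (simp add: T_def inj_on_def)
  qed
  moreover have "finite {b. (I, b) \<in> G}"
    using finite_vimageI[OF G(1), of "Pair I"] by (simp add: vimage_def inj_on_def)
  moreover have "{b. (I, b) \<in> G} \<subseteq> B I" "(\<lambda>b. c (I, b)) \<in> {b. (I, b) \<in> G} \<rightarrow> carrier K"
    using G F by auto
  moreover obtain b where "(I, b) \<in> G" using I(1) by auto
  ultimately have "c (I, b) = \<zero>\<^bsub>K\<^esub>"
    by (intro indep_modD[OF ind[OF IA], of "{b. (I, b) \<in> G}" "\<lambda>b. c (I, b)"]) (simp_all add: I)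
  then show False using \<open>(I, b) \<in> G\<close> by (auto simp: G_def)
qed

end

section \<open>Bases adapted to interval modules\<close>

context module
begin

text \<open>
  The sum runs over the support of \<open>f\<close>, which keeps it finite when \<open>J\<close> is infinite.
\<close>

definition comb :: "('j \<Rightarrow> 'c) \<Rightarrow> 'j set \<Rightarrow> ('j \<Rightarrow> 'a) \<Rightarrow> 'c" where
  "comb e J f = (\<Oplus>\<^bsub>M\<^esub>j\<in>{j \<in> J. f j \<noteq> \<zero>}. f j \<odot>\<^bsub>M\<^esub> e j)"

lemma comb_eq_finsum:
  assumes F: "finite F" "{j \<in> J. f j \<noteq> \<zero>} \<subseteq> F" "F \<subseteq> J"
    and f: "\<And>j. j \<in> J \<Longrightarrow> f j \<in> carrier R" and e: "\<And>j. j \<in> J \<Longrightarrow> e j \<in> carrier M"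
  shows "comb e J f = (\<Oplus>\<^bsub>M\<^esub>j\<in>F. f j \<odot>\<^bsub>M\<^esub> e j)"
proof -
  have cl: "f j \<odot>\<^bsub>M\<^esub> e j \<in> carrier M" if "j \<in> J" for j using f e that by (intro smult_closed)
  have supp: "{j \<in> F. f j \<noteq> \<zero>} = {j \<in> J. f j \<noteq> \<zero>}" using F by blast
  have "(\<Oplus>\<^bsub>M\<^esub>j\<in>{j \<in> F. \<not> f j \<noteq> \<zero>}. f j \<odot>\<^bsub>M\<^esub> e j) = \<zero>\<^bsub>M\<^esub>"
    using F(3) e by (intro M.add.finprod_one_eqI) auto
  moreover have "(\<Oplus>\<^bsub>M\<^esub>j\<in>F. f j \<odot>\<^bsub>M\<^esub> e j) =
      (\<Oplus>\<^bsub>M\<^esub>j\<in>{j \<in> F. f j \<noteq> \<zero>}. f j \<odot>\<^bsub>M\<^esub> e j) \<oplus>\<^bsub>M\<^esub> (\<Oplus>\<^bsub>M\<^esub>j\<in>{j \<in> F. \<not> f j \<noteq> \<zero>}. f j \<odot>\<^bsub>M\<^esub> e j)"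
    using F(3) cl by (intro finsum_split[OF F(1)]) auto
  moreover have "comb e J f \<in> carrier M"
    unfolding comb_def using cl by (intro M.finsum_closed) auto
  ultimately show ?thesis by (simp add: supp comb_def)
qed

lemma comb_closed:
  assumes "\<And>j. j \<in> J \<Longrightarrow> f j \<in> carrier R" "\<And>j. j \<in> J \<Longrightarrow> e j \<in> carrier M"
  shows "comb e J f \<in> carrier M"
  unfolding comb_def using assms by (intro M.finsum_closed) (auto intro!: smult_closed)

lemma comb_add:
  assumes f: "\<And>j. j \<in> J \<Longrightarrow> f j \<in> carrier R" "finite {j \<in> J. f j \<noteq> \<zero>}"
    and g: "\<And>j. j \<in> J \<Longrightarrow> g j \<in> carrier R" "finite {j \<in> J. g j \<noteq> \<zero>}"
    and e: "\<And>j. j \<in> J \<Longrightarrow> e j \<in> carrier M"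
    and h: "\<And>j. j \<in> J \<Longrightarrow> h j = f j \<oplus> g j"
  shows "comb e J h = comb e J f \<oplus>\<^bsub>M\<^esub> comb e J g"
proof -
  let ?F = "{j \<in> J. f j \<noteq> \<zero>} \<union> {j \<in> J. g j \<noteq> \<zero>}"
  have F: "finite ?F" "?F \<subseteq> J" using f g by auto
  have "comb e J h = (\<Oplus>\<^bsub>M\<^esub>j\<in>?F. h j \<odot>\<^bsub>M\<^esub> e j)"
    using F f g h e by (intro comb_eq_finsum) auto
  also have "\<dots> = (\<Oplus>\<^bsub>M\<^esub>j\<in>?F. f j \<odot>\<^bsub>M\<^esub> e j \<oplus>\<^bsub>M\<^esub> g j \<odot>\<^bsub>M\<^esub> e j)"
    using f g h e by (intro M.finsum_cong') (auto simp: smult_l_distr)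
  also have "\<dots> = (\<Oplus>\<^bsub>M\<^esub>j\<in>?F. f j \<odot>\<^bsub>M\<^esub> e j) \<oplus>\<^bsub>M\<^esub> (\<Oplus>\<^bsub>M\<^esub>j\<in>?F. g j \<odot>\<^bsub>M\<^esub> e j)"
    using f g e by (intro M.finsum_addf) auto
  also have "(\<Oplus>\<^bsub>M\<^esub>j\<in>?F. f j \<odot>\<^bsub>M\<^esub> e j) = comb e J f"
    using F f e by (intro comb_eq_finsum[symmetric]) auto
  also have "(\<Oplus>\<^bsub>M\<^esub>j\<in>?F. g j \<odot>\<^bsub>M\<^esub> e j) = comb e J g"
    using F g e by (intro comb_eq_finsum[symmetric]) auto
  finally show ?thesis .
qed

lemma comb_smult:
  assumes a: "a \<in> carrier R"
    and f: "\<And>j. j \<in> J \<Longrightarrow> f j \<in> carrier R" "finite {j \<in> J. f j \<noteq> \<zero>}"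
    and e: "\<And>j. j \<in> J \<Longrightarrow> e j \<in> carrier M"
    and h: "\<And>j. j \<in> J \<Longrightarrow> h j = a \<otimes> f j"
  shows "comb e J h = a \<odot>\<^bsub>M\<^esub> comb e J f"
proof -
  let ?F = "{j \<in> J. f j \<noteq> \<zero>}"
  have "comb e J h = (\<Oplus>\<^bsub>M\<^esub>j\<in>?F. h j \<odot>\<^bsub>M\<^esub> e j)"
    using f h e a by (intro comb_eq_finsum) auto
  also have "\<dots> = (\<Oplus>\<^bsub>M\<^esub>j\<in>?F. a \<odot>\<^bsub>M\<^esub> (f j \<odot>\<^bsub>M\<^esub> e j))"
    using f h e a by (intro M.finsum_cong') (auto simp: smult_assoc1)
  also have "\<dots> = a \<odot>\<^bsub>M\<^esub> comb e J f"
    unfolding comb_def using f e a by (intro finsum_smult_ldistr[symmetric]) auto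
  finally show ?thesis .
qed

end

lemma module_homI:
  assumes "\<And>x. x \<in> carrier M \<Longrightarrow> f x \<in> carrier N"
    and "\<And>x y. x \<in> carrier M \<Longrightarrow> y \<in> carrier M \<Longrightarrow> f (x \<oplus>\<^bsub>M\<^esub> y) = f x \<oplus>\<^bsub>N\<^esub> f y"
    and "\<And>a x. a \<in> carrier R \<Longrightarrow> x \<in> carrier M \<Longrightarrow> f (a \<odot>\<^bsub>M\<^esub> x) = a \<odot>\<^bsub>N\<^esub> f x"
  shows "f \<in> module_hom R M N"
  using assms by (simp add: module_hom_def)

lemma persistence_isomorphic_of_bij:
  assumes V: "persistence_module K V" and W: "persistence_module K W"
    and hom: "persistence_hom K W V \<psi>"
    and bij: "\<And>t. bij_betw (\<psi> t) (carrier (pspace W t)) (carrier (pspace V t))"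
  shows "persistence_isomorphic K V W"
proof -
  interpret V: persistence_module K V by fact
  interpret W: persistence_module K W by fact
  define \<phi> where "\<phi> t = inv_into (W.C t) (\<psi> t)" for t
  have \<psi>\<phi>: "\<psi> t (\<phi> t x) = x" if "x \<in> V.C t" for t x
    using bij[of t] that by (simp add: \<phi>_def bij_betw_inv_into_right)
  have \<phi>\<psi>: "\<phi> t (\<psi> t y) = y" if "y \<in> W.C t" for t y
    using bij[of t] that by (simp add: \<phi>_def bij_betw_inv_into_left)
  have \<phi>C: "\<phi> t x \<in> W.C t" if "x \<in> V.C t" for t x
    using bij_betwE[OF bij_betw_inv_into[OF bij[of t]]] that by (simp add: \<phi>_def)
  have mh: "\<psi> t \<in> module_hom K (pspace W t) (pspace V t)" for t
    using hom unfolding persistence_hom_def linear_map_def mod_hom_def mod_hom_axioms_def by blast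
  have nat: "\<psi> t (pmap W t s y) = pmap V t s (\<psi> s y)" if "s \<le> t" "y \<in> W.C s" for s t y
    using hom that unfolding persistence_hom_def by blast
  have "\<phi> t \<in> module_hom K (pspace V t) (pspace W t)" for t
  proof (rule module_homI)
    show "\<phi> t x \<in> W.C t" if "x \<in> V.C t" for x using \<phi>C that by blast
    fix x y assume x: "x \<in> V.C t" and y: "y \<in> V.C t"
    have "\<psi> t (\<phi> t x \<oplus>\<^bsub>pspace W t\<^esub> \<phi> t y) = x \<oplus>\<^bsub>pspace V t\<^esub> y"
      using module_hom_add[OF mh] x y \<phi>C \<psi>\<phi> by simp
    then show "\<phi> t (x \<oplus>\<^bsub>pspace V t\<^esub> y) = \<phi> t x \<oplus>\<^bsub>pspace W t\<^esub> \<phi> t y"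
      using \<phi>\<psi>[of "\<phi> t x \<oplus>\<^bsub>pspace W t\<^esub> \<phi> t y" t] x y \<phi>C by simp
  next
    fix a x assume a: "a \<in> carrier K" and x: "x \<in> V.C t"
    have "\<psi> t (a \<odot>\<^bsub>pspace W t\<^esub> \<phi> t x) = a \<odot>\<^bsub>pspace V t\<^esub> x"
      using module_hom_smult[OF mh] a x \<phi>C \<psi>\<phi> by simp
    then show "\<phi> t (a \<odot>\<^bsub>pspace V t\<^esub> x) = a \<odot>\<^bsub>pspace W t\<^esub> \<phi> t x"
      using \<phi>\<psi>[of "a \<odot>\<^bsub>pspace W t\<^esub> \<phi> t x" t] a x \<phi>C by simp
  qed
  then have "linear_map K (pspace V t) (pspace W t) (\<phi> t)" for t
    using V.vectorspace_pspace[of t] W.vectorspace_pspace[of t]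
    by (simp add: linear_map_def mod_hom_def mod_hom_axioms_def vectorspace_def)
  moreover have "\<phi> t (pmap V t s x) = pmap W t s (\<phi> s x)" if "s \<le> t" "x \<in> V.C s" for s t x
  proof -
    have "pmap V t s x = \<psi> t (pmap W t s (\<phi> s x))" using nat[OF that(1) \<phi>C[OF that(2)]] \<psi>\<phi> that by simp
    then show ?thesis using \<phi>\<psi> W.pmap_closed[OF that(1) \<phi>C[OF that(2)]] by simp
  qed
  ultimately have "persistence_hom K V W \<phi>" by (simp add: persistence_hom_def)
  then show ?thesis
    unfolding persistence_isomorphic_def using hom \<psi>\<phi> \<phi>\<psi> by blast
qed

text \<open>
  If the vectors \<open>E j t\<close>, for the \<open>j\<close> with \<open>t \<in> I j\<close>, form a basis of each \<open>V\<^sub>t\<close>, then forming linear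
  combinations is bijective from the direct sum at \<open>t\<close> to \<open>V\<^sub>t\<close>. It commutes with the structure
  maps because a basis vector goes to the next one of its thread, or to zero when it leaves \<open>I j\<close>, and
  the structure maps of \<open>interval_module\<close> drop exactly the coordinates with \<open>t \<notin> I j\<close>.
\<close>

lemma (in persistence_module) isomorphic_to_interval_sum:
  assumes int: "\<And>j. j \<in> J \<Longrightarrow> interval (I j)"
    and EC: "\<And>j t. j \<in> J \<Longrightarrow> t \<in> I j \<Longrightarrow> E j t \<in> C t"
    and Emap: "\<And>j s t. j \<in> J \<Longrightarrow> s \<in> I j \<Longrightarrow> s \<le> t \<Longrightarrow>
                 pmap V t s (E j s) = (if t \<in> I j then E j t else Z t)"
    and ind: "\<And>t. indep_mod K (pspace V t) {Z t} (\<lambda>j. E j t) {j \<in> J. t \<in> I j}"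
    and span: "\<And>t. spans_mod K (pspace V t) {Z t} (\<lambda>j. E j t) {j \<in> J. t \<in> I j} (C t)"
  shows "persistence_isomorphic K V (persistence_direct_sum J (\<lambda>j. interval_module K (I j)))"
proof -
  define W where "W = persistence_direct_sum J (\<lambda>j. interval_module K (I j))"
  have K: "field K" by (rule vectorspace.axioms(2)[OF vectorspace_pspace])
  interpret W: persistence_module K W
    unfolding W_def using K int
    by (intro persistence_module_direct_sum interval_module_is_persistence_module)
  define Jt where "Jt t = {j \<in> J. t \<in> I j}" for t
  define \<psi> where "\<psi> t f = sp.comb t (\<lambda>j. E j t) (Jt t) f" for t f
  have memW: "f \<in> W.C t \<longleftrightarrow> f \<in> extensional J \<and>
      (\<forall>j\<in>J. f j \<in> (if t \<in> I j then carrier K else {\<zero>\<^bsub>K\<^esub>})) \<and> finite {j \<in> J. f j \<noteq> \<zero>\<^bsub>K\<^esub>}" for t f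
    by (simp add: W_def persistence_direct_sum_def module_direct_sum_mem interval_module_def)
  have supp: "{j \<in> J. f j \<noteq> \<zero>\<^bsub>K\<^esub>} = {j \<in> Jt t. f j \<noteq> \<zero>\<^bsub>K\<^esub>}" if "f \<in> W.C t" for t f
    using that unfolding memW Jt_def by (auto split: if_splits)
  have fin: "finite {j \<in> Jt t. f j \<noteq> \<zero>\<^bsub>K\<^esub>}" if "f \<in> W.C t" for t f
    using that supp[OF that] unfolding memW by simp
  have fK: "f j \<in> carrier K" if "f \<in> W.C t" "j \<in> Jt t" for t f j
    using that unfolding memW Jt_def by (auto split: if_splits)
  have EJ: "E j t \<in> C t" if "j \<in> Jt t" for t j using EC that by (auto simp: Jt_def)
  have opsW: "(f \<oplus>\<^bsub>pspace W t\<^esub> g) j = f j \<oplus>\<^bsub>K\<^esub> g j" "(a \<odot>\<^bsub>pspace W t\<^esub> f) j = a \<otimes>\<^bsub>K\<^esub> f j"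
    if "j \<in> J" for f g a j t
    using that by (simp_all add: W_def persistence_direct_sum_def module_direct_sum_simps interval_module_def)
  have zeroW: "\<zero>\<^bsub>pspace W t\<^esub> = (\<lambda>j\<in>J. \<zero>\<^bsub>K\<^esub>)" for t
    by (simp add: W_def persistence_direct_sum_def module_direct_sum_simps interval_module_def)
  have mapW: "pmap W t s f j = (if s \<in> I j \<and> t \<in> I j then f j else \<zero>\<^bsub>K\<^esub>)" if "j \<in> J" for f s t j
    using that by (simp add: W_def persistence_direct_sum_def interval_module_def)
  have "\<psi> t \<in> module_hom K (pspace W t) (pspace V t)" for t
  proof (rule module_homI)
    show "\<psi> t f \<in> C t" if "f \<in> W.C t" for f
      unfolding \<psi>_def using fK[OF that] EJ by (intro sp.comb_closed)
    show "\<psi> t (f \<oplus>\<^bsub>pspace W t\<^esub> g) = \<psi> t f \<oplus>\<^bsub>pspace V t\<^esub> \<psi> t g" if "f \<in> W.C t" "g \<in> W.C t" for f g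
      unfolding \<psi>_def using fK[OF that(1)] fK[OF that(2)] fin[OF that(1)] fin[OF that(2)] EJ opsW
      by (intro sp.comb_add) (auto simp: Jt_def)
    show "\<psi> t (a \<odot>\<^bsub>pspace W t\<^esub> f) = a \<odot>\<^bsub>pspace V t\<^esub> \<psi> t f" if "a \<in> carrier K" "f \<in> W.C t" for a f
      unfolding \<psi>_def using fK[OF that(2)] fin[OF that(2)] that(1) EJ opsW
      by (intro sp.comb_smult) (auto simp: Jt_def)
  qed
  then have lin: "linear_map K (pspace W t) (pspace V t) (\<psi> t)" for t
    using vectorspace_pspace[of t] W.vectorspace_pspace[of t]
    by (simp add: linear_map_def mod_hom_def mod_hom_axioms_def vectorspace_def)
  have nat: "\<psi> t (pmap W t s f) = pmap V t s (\<psi> s f)" if st: "s \<le> t" and f: "f \<in> W.C s" for s t f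
  proof -
    let ?S = "{j \<in> Jt s. f j \<noteq> \<zero>\<^bsub>K\<^esub>}"
    have S: "finite ?S" by (rule fin[OF f])
    have "pmap V t s (\<psi> s f) = (\<Oplus>\<^bsub>pspace V t\<^esub>j\<in>?S. f j \<odot>\<^bsub>pspace V t\<^esub> pmap V t s (E j s))"
      unfolding \<psi>_def sp.comb_def using fK[OF f] EJ by (intro pmap_comb[OF st S]) auto
    also have "\<dots> = (\<Oplus>\<^bsub>pspace V t\<^esub>j\<in>{j \<in> ?S. t \<in> I j}. f j \<odot>\<^bsub>pspace V t\<^esub> pmap V t s (E j s))
        \<oplus>\<^bsub>pspace V t\<^esub> (\<Oplus>\<^bsub>pspace V t\<^esub>j\<in>{j \<in> ?S. t \<notin> I j}. f j \<odot>\<^bsub>pspace V t\<^esub> pmap V t s (E j s))"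
      using fK[OF f] EJ st by (intro sp.finsum_split[OF S]) auto
    also have "(\<Oplus>\<^bsub>pspace V t\<^esub>j\<in>{j \<in> ?S. t \<notin> I j}. f j \<odot>\<^bsub>pspace V t\<^esub> pmap V t s (E j s)) = Z t"
      using fK[OF f] Emap st by (intro sp.M.add.finprod_one_eqI) (auto simp: Jt_def)
    also have "(\<Oplus>\<^bsub>pspace V t\<^esub>j\<in>{j \<in> ?S. t \<in> I j}. f j \<odot>\<^bsub>pspace V t\<^esub> pmap V t s (E j s))
        = (\<Oplus>\<^bsub>pspace V t\<^esub>j\<in>{j \<in> Jt t. pmap W t s f j \<noteq> \<zero>\<^bsub>K\<^esub>}. pmap W t s f j \<odot>\<^bsub>pspace V t\<^esub> E j t)"
      using fK[OF f] Emap st EC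
      by (intro sp.M.finsum_cong') (auto simp: Jt_def mapW split: if_splits)
    also have "\<dots> = \<psi> t (pmap W t s f)" by (simp add: \<psi>_def sp.comb_def)
    finally have "pmap V t s (\<psi> s f) = \<psi> t (pmap W t s f) \<oplus>\<^bsub>pspace V t\<^esub> Z t" .
    moreover have "\<psi> t (pmap W t s f) \<in> C t"
      unfolding \<psi>_def using fK[OF W.pmap_closed[OF st f]] EJ by (intro sp.comb_closed)
    ultimately show ?thesis by simp
  qed
  have bij: "bij_betw (\<psi> t) (W.C t) (C t)" for t
  proof -
    interpret p: linear_map K "pspace W t" "pspace V t" "\<psi> t" by (rule lin)
    have ker: "f = \<zero>\<^bsub>pspace W t\<^esub>" if f: "f \<in> W.C t" and 0: "\<psi> t f = Z t" for f
    proof -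
      have "\<forall>j\<in>{j \<in> Jt t. f j \<noteq> \<zero>\<^bsub>K\<^esub>}. f j = \<zero>\<^bsub>K\<^esub>"
        using ind[of t] fin[OF f] fK[OF f] 0 unfolding indep_mod_def \<psi>_def sp.comb_def Jt_def[symmetric]
        by (auto simp: Pi_iff)
      then have "{j \<in> J. f j \<noteq> \<zero>\<^bsub>K\<^esub>} = {}" using supp[OF f] by auto
      then show ?thesis using f unfolding zeroW memW by (auto simp: fun_eq_iff extensional_def)
    qed
    have "inj_on (\<psi> t) (W.C t)"
    proof (rule inj_onI)
      fix f g assume fg: "f \<in> W.C t" "g \<in> W.C t" "\<psi> t f = \<psi> t g"
      then have "\<psi> t (f \<ominus>\<^bsub>pspace W t\<^esub> g) = Z t"
        using p.f_im by (simp add: p.f_minus a_minus_def sp.M.r_neg)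
      then have "f \<ominus>\<^bsub>pspace W t\<^esub> g = \<zero>\<^bsub>pspace W t\<^esub>" using fg by (intro ker) auto
      then show "f = g" using fg W.sp.diff_add_cancel[of f t g] by simp
    qed
    moreover have "C t \<subseteq> \<psi> t ` W.C t"
    proof -
      have "submodule K (\<psi> t ` W.C t) (pspace V t)"
        using p.im_is_submodule unfolding p.im_def .
      moreover have "E j t \<in> \<psi> t ` W.C t" if j: "j \<in> Jt t" for j
      proof
        let ?f = "\<lambda>k\<in>J. if k = j then \<one>\<^bsub>K\<^esub> else \<zero>\<^bsub>K\<^esub>"
        have jJ: "j \<in> J" "t \<in> I j" using j by (auto simp: Jt_def)
        have "{k \<in> J. ?f k \<noteq> \<zero>\<^bsub>K\<^esub>} = {j}" using jJ domain.one_not_zero[OF field.axioms(1)[OF K]] by auto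
        then show "?f \<in> W.C t" using jJ unfolding memW by auto
        have "{k \<in> Jt t. ?f k \<noteq> \<zero>\<^bsub>K\<^esub>} = {j}" using j domain.one_not_zero[OF field.axioms(1)[OF K]] by (auto simp: Jt_def)
        then show "E j t = \<psi> t ?f" using EJ[OF j] jJ by (simp add: \<psi>_def sp.comb_def)
      qed
      moreover have "{Z t} \<subseteq> \<psi> t ` W.C t"
        using sp.submodule_zero_mem[OF calculation(1)] by simp
      ultimately show ?thesis using span[of t] unfolding spans_mod_def Jt_def[symmetric] by blast
    qed
    ultimately show ?thesis using p.f_im unfolding bij_betw_def by blast
  qed
  have "persistence_hom K W V \<psi>" using lin nat by (simp add: persistence_hom_def)
  then show ?thesis
    using persistence_isomorphic_of_bij[OF persistence_module_axioms W.persistence_module_axioms _ bij]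
    by (simp add: W_def)
qed

section \<open>The decomposition\<close>

text \<open>
  The second component of an index tells apart the threads of one interval: it is an element of the
  basis from which the threads of that interval were made.
\<close>

theorem interval_decomposition:
  fixes V :: "('r::linorder_topology, 'k, 'v) persistence"
  assumes sep: "countable D" "closure D = (UNIV :: 'r set)"
    and V: "persistence_module K V"
    and dccI: "dcc_images V" and dccK: "dcc_kernels V"
  shows "\<exists>J :: ('r set \<times> 'v) set. (\<forall>j\<in>J. interval (fst j)) \<and>
           persistence_isomorphic K V
             (persistence_direct_sum J (\<lambda>j. interval_module K (fst j)))"
proof -
  interpret persistence_module K V by fact
  let ?P = "\<lambda>I. V_plus (lower_cut I) (upper_cut I)"
  let ?N = "\<lambda>I. V_minus (lower_cut I) (upper_cut I)"
  have "\<exists>B e. thread_basis (lower_cut I) (upper_cut I) B e" if I: "interval I" for I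
  proof -
    obtain a where a: "\<And>n. a n \<in> I" "\<And>n::nat. a (Suc n) \<le> a n" "\<And>s. s \<in> I \<Longrightarrow> \<exists>n. a n \<le> s"
      using coinitial_sequence[OF sep I] by metis
    note cuts = interval_eq_cuts[OF I, symmetric]
    show ?thesis
      using a(2) by (intro exists_thread_basis[OF dccI upper_set_lower_cut upper_set_upper_cut, of a])
        (auto simp: cuts a)
  qed
  then obtain B e where basis: "\<And>I. interval I \<Longrightarrow> thread_basis (lower_cut I) (upper_cut I) (B I) (e I)"
    by metis
  define E where "E j = e (fst j) (snd j)" for j
  define J where "J = Sigma {I. interval I} B"
  have EV: "E (I, b) t \<in> ?P I t" if "interval I" "b \<in> B I" "t \<in> I" for I b t
    using basis[OF that(1)] that interval_eq_cuts[OF that(1)]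
    by (simp add: E_def thread_basis_def)
  have comp: "pmap V t s (E (I, b) s) = E (I, b) t"
    if "interval I" "b \<in> B I" "s \<in> I" "t \<in> I" "s \<le> t" for I b s t
    using basis[OF that(1)] that interval_eq_cuts[OF that(1)]
    by (simp add: E_def thread_basis_def)
  have ind: "indep_mod K (pspace V t) (?N I t) (\<lambda>b. E (I, b) t) (B I)"
    and span: "spans_mod K (pspace V t) (?N I t) (\<lambda>b. E (I, b) t) (B I) (?P I t)"
    if "interval I" "t \<in> I" for I t
    using basis[OF that(1)] that interval_eq_cuts[OF that(1)]
    by (simp_all add: E_def thread_basis_def)
  have Jt: "{j \<in> J. t \<in> fst j} = Sigma {I. interval I \<and> t \<in> I} B" for t
    by (auto simp: J_def)
  have "persistence_isomorphic K V (persistence_direct_sum J (\<lambda>j. interval_module K (fst j)))"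
  proof (rule isomorphic_to_interval_sum)
    show int: "interval (fst j)" if "j \<in> J" for j using that by (auto simp: J_def)
    show "E j t \<in> C t" if "j \<in> J" "t \<in> fst j" for j t
      using that EV[of "fst j" "snd j" t] sp.submodule_subset[OF submodule_V_plus]
      by (force simp: J_def)
    show "pmap V t s (E j s) = (if t \<in> fst j then E j t else Z t)"
      if j: "j \<in> J" and s: "s \<in> fst j" and st: "s \<le> t" for j s t
    proof (cases "t \<in> fst j")
      case True
      then show ?thesis using comp[of "fst j" "snd j" s t] that by (auto simp: J_def)
    next
      case False
      have "i < t" if i: "i \<in> fst j" for i
        using int[OF j] s st False i unfolding interval_def by (meson not_le)
      then have "t \<in> upper_cut (fst j)" by (simp add: upper_cut_def)
      moreover have "E j s \<in> ker_plus (upper_cut (fst j)) s"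
        using EV[of "fst j" "snd j" s] j s by (auto simp: J_def V_plus_def)
      ultimately show ?thesis using st False by (simp add: ker_plus_def)
    qed
    show "indep_mod K (pspace V t) {Z t} (\<lambda>j. E j t) {j \<in> J. t \<in> fst j}" for t
      unfolding Jt using EV ind by (intro indep_from_intervals) auto
    show "spans_mod K (pspace V t) {Z t} (\<lambda>j. E j t) {j \<in> J. t \<in> fst j} (C t)" for t
      unfolding Jt spans_mod_def
    proof (intro allI impI, elim conjE)
      fix X assume X: "submodule K X (pspace V t)"
        and E: "(\<lambda>j. E j t) ` Sigma {I. interval I \<and> t \<in> I} B \<subseteq> X"
      show "C t \<subseteq> X"
      proof (rule spans_from_intervals[OF dccI dccK X])
        fix I assume I: "interval I" "t \<in> I" and N: "?N I t \<subseteq> X"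
        have "(\<lambda>b. E (I, b) t) ` B I \<subseteq> X" using E I by auto
        then show "?P I t \<subseteq> X" using span[OF I] X N unfolding spans_mod_def by simp
      qed
    qed
  qed
  moreover have "\<forall>j\<in>J. interval (fst j)" by (auto simp: J_def)
  ultimately show ?thesis by (intro exI[of _ J] conjI)
qed

theorem theorem1p2:
  fixes V :: "('r::linorder_topology, 'k::field, 'v) persistence"
  assumes "\<exists>D :: 'r set. countable D \<and> closure D = UNIV"
    and "persistence_module class_ring V"
    and "dcc_images V" and "dcc_kernels V"
  shows "\<exists>(J :: ('r set \<times> 'v) set) (I :: 'r set \<times> 'v \<Rightarrow> 'r set).
           (\<forall>j\<in>J. interval (I j)) \<and>
           persistence_isomorphic class_ring V
             (persistence_direct_sum J (\<lambda>j. interval_module class_ring (I j)))"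
proof -
  obtain D :: "'r set" where D: "countable D" "closure D = UNIV" using assms(1) by blast
  obtain J :: "('r set \<times> 'v) set" where "(\<forall>j\<in>J. interval (fst j)) \<and>
      persistence_isomorphic class_ring V
        (persistence_direct_sum J (\<lambda>j. interval_module class_ring (fst j)))"
    using interval_decomposition[OF D assms(2-4)] by (rule exE)
  then show ?thesis by (intro exI[of _ J] exI[of _ fst])
qed

end
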